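(* There exists a finitely generated branch group that is in $\mathcal{MF}$ but not in the class $\mathcal{MN}$ of groups with all maximal subgroups normal.
   Context: $\mathcal{MF}$ is the class of groups all of whose maximal subgroups have finite index; $\mathcal{MN}$ is the class of groups all of whose maximal subgroups are normal. For a finite non-empty set $X$, $X^\ast$ is the rooted tree of finite words over $X$ (root the empty word; $u$ is joined to $ux$ for $x\in X$), and $\mathrm{Aut}(X^\ast)$ is its group of automorphisms. A subgroup $G\le\mathrm{Aut}(X^\ast)$ is spherically transitive if it acts transitively on the set $X^n$ of words of length $n$ for every $n$. The rigid vertex stabiliser $\mathrm{rist}_G(v)$ of a vertex $v$ is the subgroup of all elements of $G$ that fix every vertex outside the subtree $vX^\ast$; $\mathrm{Rist}_G(n)$ is the product of all $\mathrm{rist}_G(v)$ with $v\in X^n$. A spherically transitive group $G$ is a branch group if $\mathrm{Rist}_G(n)$ has finite index in $G$ for every $n\in\mathbb{N}$. *)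

theory Defs
  imports "HOL-Algebra.Bij" "HOL-Algebra.Generated_Groups"
begin

definition maximal_subgroup :: "'a set \<Rightarrow> ('a, 'b) monoid_scheme \<Rightarrow> bool" where
  "maximal_subgroup M H \<longleftrightarrow>
     subgroup M H \<and> M \<noteq> carrier H \<and>
     (\<forall>K. subgroup K H \<and> M \<subseteq> K \<longrightarrow> K = M \<or> K = carrier H)"

definition finite_index :: "'a set \<Rightarrow> ('a, 'b) monoid_scheme \<Rightarrow> bool" where
  "finite_index K H \<longleftrightarrow> subgroup K H \<and> finite (rcosets\<^bsub>H\<^esub> K)"

definition finitely_generated_group :: "('a, 'b) monoid_scheme \<Rightarrow> bool" where
  "finitely_generated_group H \<longleftrightarrow>
     group H \<and> (\<exists>S. finite S \<and> S \<subseteq> carrier H \<and> generate H S = carrier H)"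

definition in_MF :: "('a, 'b) monoid_scheme \<Rightarrow> bool" where
  "in_MF H \<longleftrightarrow> group H \<and> (\<forall>M. maximal_subgroup M H \<longrightarrow> finite_index M H)"

definition in_MN :: "('a, 'b) monoid_scheme \<Rightarrow> bool" where
  "in_MN H \<longleftrightarrow> group H \<and> (\<forall>M. maximal_subgroup M H \<longrightarrow> M \<lhd> H)"

text \<open>The tree of words over \<open>A\<close> has vertex set \<^term>\<open>lists A\<close> and root \<^term>\<open>[]\<close>.\<close>

definition tree_adj :: "'x set \<Rightarrow> 'x list \<Rightarrow> 'x list \<Rightarrow> bool" where
  "tree_adj A u v \<longleftrightarrow>
     u \<in> lists A \<and> v \<in> lists A \<and> (\<exists>x\<in>A. v = u @ [x] \<or> u = v @ [x])"

definition level :: "'x set \<Rightarrow> nat \<Rightarrow> 'x list set" where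
  "level A n = {w \<in> lists A. length w = n}"

definition subtree :: "'x set \<Rightarrow> 'x list \<Rightarrow> 'x list set" where
  "subtree A v = {v @ w | w. w \<in> lists A}"

text \<open>Automorphisms are extensional functions, as in \<^term>\<open>BijGroup\<close>; the product
  of \<open>f\<close> and \<open>g\<close> is the composition applying \<open>g\<close> first.\<close>

definition tree_Aut :: "'x set \<Rightarrow> ('x list \<Rightarrow> 'x list) monoid" where
  "tree_Aut A = (BijGroup (lists A))
     \<lparr>carrier := {f \<in> Bij (lists A). f [] = [] \<and>
        (\<forall>u\<in>lists A. \<forall>v\<in>lists A. tree_adj A (f u) (f v) \<longleftrightarrow> tree_adj A u v)}\<rparr>"

text \<open>A subgroup \<open>G\<close> of the automorphism group, regarded as a group in its own right.\<close>

abbreviation tree_grp ::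
    "'x set \<Rightarrow> ('x list \<Rightarrow> 'x list) set \<Rightarrow> ('x list \<Rightarrow> 'x list) monoid" where
  "tree_grp A G \<equiv> (tree_Aut A)\<lparr>carrier := G\<rparr>"

definition spherically_transitive :: "'x set \<Rightarrow> ('x list \<Rightarrow> 'x list) set \<Rightarrow> bool" where
  "spherically_transitive A G \<longleftrightarrow>
     (\<forall>n. \<forall>u\<in>level A n. \<forall>v\<in>level A n. \<exists>g\<in>G. g u = v)"

definition rist ::
    "'x set \<Rightarrow> ('x list \<Rightarrow> 'x list) set \<Rightarrow> 'x list \<Rightarrow> ('x list \<Rightarrow> 'x list) set" where
  "rist A G v = {g \<in> G. \<forall>u \<in> lists A - subtree A v. g u = u}"

text \<open>The rigid stabilisers of distinct vertices of the same level commute elementwise, so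
  their product does not depend on the order and is the subgroup that they generate; see
  \<open>Rist_eq_product\<close> below.\<close>

definition Rist ::
    "'x set \<Rightarrow> ('x list \<Rightarrow> 'x list) set \<Rightarrow> nat \<Rightarrow> ('x list \<Rightarrow> 'x list) set" where
  "Rist A G n = generate (tree_grp A G) (\<Union>v\<in>level A n. rist A G v)"

definition branch_group :: "'x set \<Rightarrow> ('x list \<Rightarrow> 'x list) set \<Rightarrow> bool" where
  "branch_group A G \<longleftrightarrow>
     finite A \<and> A \<noteq> {} \<and> subgroup G (tree_Aut A) \<and> spherically_transitive A G \<and>
     (\<forall>n. finite_index (Rist A G n) (tree_grp A G))"

lemma tree_Aut_subgroup: "subgroup (carrier (tree_Aut A)) (BijGroup (lists A))"
proof -
  interpret B: group "BijGroup (lists A)" by (rule group_BijGroup)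
  show ?thesis
  proof (rule B.subgroupI)
    show "carrier (tree_Aut A) \<subseteq> carrier (BijGroup (lists A))"
      by (auto simp: tree_Aut_def BijGroup_def)
    have "(\<lambda>x\<in>lists A. x) \<in> carrier (tree_Aut A)"
      by (auto simp: tree_Aut_def id_Bij)
    then show "carrier (tree_Aut A) \<noteq> {}" by blast
  next
    fix f assume f: "f \<in> carrier (tree_Aut A)"
    then have fB: "f \<in> Bij (lists A)" and f0: "f [] = []"
      and fa: "\<And>u v. u \<in> lists A \<Longrightarrow> v \<in> lists A \<Longrightarrow> tree_adj A (f u) (f v) \<longleftrightarrow> tree_adj A u v"
      by (auto simp: tree_Aut_def)
    let ?h = "\<lambda>x\<in>lists A. inv_into (lists A) f x"
    have h: "?h u \<in> lists A" "f (?h u) = u" if "u \<in> lists A" for u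
      using that fB
      by (simp_all add: Bij_inv_into_mem) (auto simp: Bij_def bij_betw_def f_inv_into_f)
    have "?h [] = []"
      using fB f0 by (simp add: Bij_def bij_betw_def) (metis inv_into_f_f lists.Nil)
    moreover have "tree_adj A (?h u) (?h v) \<longleftrightarrow> tree_adj A u v"
      if "u \<in> lists A" "v \<in> lists A" for u v
      using fa[OF h(1)[OF that(1)] h(1)[OF that(2)]] h(2)[OF that(1)] h(2)[OF that(2)] by simp
    ultimately have "?h \<in> carrier (tree_Aut A)"
      using restrict_inv_into_Bij[OF fB] unfolding tree_Aut_def by simp
    then show "inv\<^bsub>BijGroup (lists A)\<^esub> f \<in> carrier (tree_Aut A)"
      using fB by (simp add: inv_BijGroup)
  next
    fix f g assume fg: "f \<in> carrier (tree_Aut A)" "g \<in> carrier (tree_Aut A)"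
    then have B: "f \<in> Bij (lists A)" "g \<in> Bij (lists A)" by (auto simp: tree_Aut_def)
    have "\<And>u. u \<in> lists A \<Longrightarrow> g u \<in> lists A" using B(2) Bij_imp_funcset by blast
    then have "compose (lists A) f g \<in> carrier (tree_Aut A)"
      using fg compose_Bij[OF B] unfolding tree_Aut_def by (simp add: compose_def)
    then show "f \<otimes>\<^bsub>BijGroup (lists A)\<^esub> g \<in> carrier (tree_Aut A)"
      using B by (simp add: BijGroup_def)
  qed
qed

lemma group_tree_Aut: "group (tree_Aut A)"
proof -
  have "tree_Aut A = (BijGroup (lists A))\<lparr>carrier := carrier (tree_Aut A)\<rparr>"
    by (simp add: tree_Aut_def)
  then show ?thesis
    using group.subgroup_imp_group[OF group_BijGroup tree_Aut_subgroup] by metis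
qed

lemma group_tree_grp: "subgroup G (tree_Aut A) \<Longrightarrow> group (tree_grp A G)"
  by (rule group.subgroup_imp_group[OF group_tree_Aut])

lemma tree_grp_Bij: "subgroup G (tree_Aut A) \<Longrightarrow> g \<in> G \<Longrightarrow> g \<in> Bij (lists A)"
  using subgroup.subset by (fastforce simp: tree_Aut_def)

lemma tree_grp_mult:
  assumes "subgroup G (tree_Aut A)" "f \<in> G" "g \<in> G"
  shows "f \<otimes>\<^bsub>tree_grp A G\<^esub> g = compose (lists A) f g"
  using tree_grp_Bij[OF assms(1)] assms(2,3) by (simp add: tree_Aut_def BijGroup_def)

lemma rist_subgroup:
  assumes G: "subgroup G (tree_Aut A)"
  shows "subgroup (rist A G v) (tree_grp A G)"
proof -
  interpret H: group "tree_grp A G" by (rule group_tree_grp[OF G])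
  have one: "\<one>\<^bsub>tree_grp A G\<^esub> = (\<lambda>x\<in>lists A. x)" by (simp add: tree_Aut_def BijGroup_def)
  show ?thesis
  proof (rule H.subgroupI)
    show "rist A G v \<subseteq> carrier (tree_grp A G)" by (auto simp: rist_def)
    have "\<one>\<^bsub>tree_grp A G\<^esub> \<in> rist A G v" using H.one_closed by (simp add: rist_def one)
    then show "rist A G v \<noteq> {}" by blast
  next
    fix g assume g: "g \<in> rist A G v"
    then have gG: "g \<in> G" by (simp add: rist_def)
    let ?h = "inv\<^bsub>tree_grp A G\<^esub> g"
    have hG: "?h \<in> G" using H.inv_closed gG by simp
    have c: "compose (lists A) ?h g = (\<lambda>x\<in>lists A. x)"
      using H.l_inv[of g] gG hG tree_grp_mult[OF G hG gG] one by simp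
    have "?h u = u" if u: "u \<in> lists A - subtree A v" for u
    proof -
      have "g u = u" using g u by (simp add: rist_def)
      then show ?thesis using fun_cong[OF c, of u] u by (simp add: compose_def)
    qed
    then show "?h \<in> rist A G v" using hG by (simp add: rist_def)
  next
    fix f g assume fg: "f \<in> rist A G v" "g \<in> rist A G v"
    then have m: "f \<in> G" "g \<in> G" by (auto simp: rist_def)
    have "f \<otimes>\<^bsub>tree_grp A G\<^esub> g \<in> G" using H.m_closed m by simp
    then show "f \<otimes>\<^bsub>tree_grp A G\<^esub> g \<in> rist A G v"
      using fg tree_grp_mult[OF G m] by (simp add: rist_def compose_def)
  qed
qed

lemma rist_maps_subtree:
  assumes G: "subgroup G (tree_Aut A)" and g: "g \<in> rist A G v" and v: "v \<in> lists A"
    and u: "u \<in> subtree A v"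
  shows "g u \<in> subtree A v"
proof (rule ccontr)
  assume n: "g u \<notin> subtree A v"
  have B: "g \<in> Bij (lists A)" using g tree_grp_Bij[OF G] by (simp add: rist_def)
  have ul: "u \<in> lists A" using u v by (auto simp: subtree_def)
  then have gl: "g u \<in> lists A" using B Bij_imp_funcset by blast
  have "g (g u) = g u" using g n gl by (simp add: rist_def)
  then have "g u = u" using B gl ul by (auto simp: Bij_def bij_betw_def inj_on_def)
  with n u show False by simp
qed

lemma rist_commute:
  assumes G: "subgroup G (tree_Aut A)"
    and uv: "u \<in> level A n" "v \<in> level A n" "u \<noteq> v"
    and f: "f \<in> rist A G u" and g: "g \<in> rist A G v"
  shows "f \<otimes>\<^bsub>tree_grp A G\<^esub> g = g \<otimes>\<^bsub>tree_grp A G\<^esub> f"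
proof -
  have l: "u \<in> lists A" "v \<in> lists A" using uv by (auto simp: level_def)
  have sl: "subtree A u \<subseteq> lists A" "subtree A v \<subseteq> lists A" using l by (auto simp: subtree_def)
  have d: "subtree A u \<inter> subtree A v = {}" using uv by (auto simp: subtree_def level_def)
  have m: "f \<in> G" "g \<in> G" using f g by (auto simp: rist_def)
  have "f (g w) = g (f w)" if w: "w \<in> lists A" for w
  proof -
    consider "w \<in> subtree A u" | "w \<in> subtree A v" | "w \<notin> subtree A u" "w \<notin> subtree A v" by blast
    then show ?thesis
    proof cases
      case 1
      have "f w \<in> lists A - subtree A v" "w \<in> lists A - subtree A v"
        using rist_maps_subtree[OF G f l(1) 1] sl d 1 by auto
      then show ?thesis using g by (simp add: rist_def)
    next
      case 2
      have "g w \<in> lists A - subtree A u" "w \<in> lists A - subtree A u"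
        using rist_maps_subtree[OF G g l(2) 2] sl d 2 by auto
      then show ?thesis using f by (simp add: rist_def)
    next
      case 3
      then show ?thesis using f g w by (simp add: rist_def)
    qed
  qed
  then have "compose (lists A) f g = compose (lists A) g f"
    by (auto simp: compose_def restrict_def)
  then show ?thesis using tree_grp_mult[OF G] m by simp
qed

lemma (in group) generate_eq_product:
  assumes "distinct vs"
    and "\<And>v. v \<in> set vs \<Longrightarrow> subgroup (K v) G"
    and "\<And>u v a b. \<lbrakk>u \<in> set vs; v \<in> set vs; u \<noteq> v; a \<in> K u; b \<in> K v\<rbrakk> \<Longrightarrow> a \<otimes> b = b \<otimes> a"
  shows "generate G (\<Union>v\<in>set vs. K v) = foldr (\<lambda>v P. K v <#> P) vs {\<one>}"
  using assms
proof (induction vs)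
  case Nil
  show ?case by (simp add: generate_empty)
next
  case (Cons v vs)
  let ?U = "\<Union>w\<in>set vs. K w"
  let ?P = "generate G ?U"
  have U: "?U \<subseteq> carrier G" using Cons.prems(2) subgroup.subset by fastforce
  have P: "subgroup ?P G" by (rule generate_is_subgroup[OF U])
  have K: "subgroup (K v) G" using Cons.prems(2) by simp
  note Pc = subgroup.mem_carrier[OF P] and Kc = subgroup.mem_carrier[OF K]
  have comm: "a \<otimes> p = p \<otimes> a" if a: "a \<in> K v" and "p \<in> ?P" for a p
    using that(2)
  proof (induction p rule: generate.induct)
    case one
    show ?case using Kc[OF a] by simp
  next
    case (incl h)
    then obtain w where "w \<in> set vs" "h \<in> K w" by blast
    moreover have "w \<noteq> v" using Cons.prems(1) \<open>w \<in> set vs\<close> by auto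
    ultimately show ?case using Cons.prems(3)[of v w a h] a by auto
  next
    case (inv h)
    then obtain w where w: "w \<in> set vs" "h \<in> K w" by blast
    have "w \<noteq> v" using Cons.prems(1) w by auto
    moreover have "inv h \<in> K w" using w Cons.prems(2) subgroup.m_inv_closed by fastforce
    ultimately show ?case using Cons.prems(3)[of v w a "inv h"] a w by auto
  next
    case (eng p q)
    then show ?case using Kc[OF a] Pc by (metis m_assoc)
  qed
  have S: "subgroup (K v <#> ?P) G"
  proof (rule subgroupI)
    show "K v <#> ?P \<subseteq> carrier G" using Kc Pc by (auto simp: set_mult_def)
    show "K v <#> ?P \<noteq> {}"
      using subgroup.one_closed[OF K] subgroup.one_closed[OF P] by (auto simp: set_mult_def)
  next
    fix x assume "x \<in> K v <#> ?P"
    then obtain a p where x: "a \<in> K v" "p \<in> ?P" "x = a \<otimes> p" by (auto simp: set_mult_def)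
    have ia: "inv a \<in> K v" "inv p \<in> ?P"
      using subgroup.m_inv_closed[OF K x(1)] subgroup.m_inv_closed[OF P x(2)] by auto
    have "inv x = inv p \<otimes> inv a" using x Kc Pc by (simp add: inv_mult_group)
    also have "\<dots> = inv a \<otimes> inv p" using comm[OF ia] by simp
    finally show "inv x \<in> K v <#> ?P" using ia by (auto simp: set_mult_def)
  next
    fix x y assume "x \<in> K v <#> ?P" "y \<in> K v <#> ?P"
    then obtain a p b q where x: "a \<in> K v" "p \<in> ?P" "x = a \<otimes> p"
      and y: "b \<in> K v" "q \<in> ?P" "y = b \<otimes> q" by (auto simp: set_mult_def)
    have c: "a \<in> carrier G" "b \<in> carrier G" "p \<in> carrier G" "q \<in> carrier G"
      using x y Kc Pc by auto
    have "x \<otimes> y = a \<otimes> ((p \<otimes> b) \<otimes> q)" using x(3) y(3) c by (simp add: m_assoc)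
    also have "\<dots> = a \<otimes> ((b \<otimes> p) \<otimes> q)" using comm[OF y(1) x(2)] by simp
    also have "\<dots> = (a \<otimes> b) \<otimes> (p \<otimes> q)" using c by (simp add: m_assoc)
    finally show "x \<otimes> y \<in> K v <#> ?P"
      using subgroup.m_closed[OF K x(1) y(1)] subgroup.m_closed[OF P x(2) y(2)]
      by (auto simp: set_mult_def)
  qed
  have "generate G (K v \<union> ?U) = K v <#> ?P"
  proof
    have "K v \<subseteq> K v <#> ?P"
    proof
      fix a assume a: "a \<in> K v"
      then have "a = a \<otimes> \<one>" using Kc by simp
      then show "a \<in> K v <#> ?P" using a subgroup.one_closed[OF P] by (auto simp: set_mult_def)
    qed
    moreover have "?U \<subseteq> K v <#> ?P"
    proof
      fix p assume p: "p \<in> ?U"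
      then have "p = \<one> \<otimes> p" using U by auto
      then show "p \<in> K v <#> ?P"
        using generate.incl[OF p] subgroup.one_closed[OF K] by (auto simp: set_mult_def)
    qed
    ultimately show "generate G (K v \<union> ?U) \<subseteq> K v <#> ?P"
      using generate_subgroup_incl[OF _ S] by simp
    have "?P \<subseteq> generate G (K v \<union> ?U)" by (rule mono_generate) simp
    then show "K v <#> ?P \<subseteq> generate G (K v \<union> ?U)"
      by (auto simp: set_mult_def intro!: generate.eng intro: generate.incl)
  qed
  moreover have "?P = foldr (\<lambda>v P. K v <#> P) vs {\<one>}"
  proof (rule Cons.IH)
    show "distinct vs" using Cons.prems(1) by simp
    show "subgroup (K w) G" if "w \<in> set vs" for w using Cons.prems(2) that by simp
    show "a \<otimes> b = b \<otimes> a"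
      if "u \<in> set vs" "w \<in> set vs" "u \<noteq> w" "a \<in> K u" "b \<in> K w" for u w a b
      by (rule Cons.prems(3)[of u w]) (use that in simp_all)
  qed
  ultimately show ?case by simp
qed

lemma Rist_eq_product:
  assumes G: "subgroup G (tree_Aut A)" and vs: "distinct vs" "set vs = level A n"
  shows "Rist A G n =
    foldr (\<lambda>v P. rist A G v <#>\<^bsub>tree_grp A G\<^esub> P) vs {\<one>\<^bsub>tree_grp A G\<^esub>}"
proof -
  interpret H: group "tree_grp A G" by (rule group_tree_grp[OF G])
  show ?thesis
    using H.generate_eq_product[of vs "rist A G"] vs rist_subgroup[OF G] rist_commute[OF G]
    unfolding Rist_def by metis
qed

end

theory Submission
  imports Defs "HOL-Library.Numeral_Type"
begin

text \<open>
  Let \<open>\<Gamma> = \<langle>a, t\<rangle>\<close> be the Gupta-Sidki 3-group: it acts on the ternary tree, \<open>a\<close> permutes the three letters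
  cyclically and \<open>t\<close> fixes the first level with sections \<open>(t, a, a\<^sup>-\<^sup>1)\<close>. The required group is
  \<open>G = \<Gamma> wr S\<^sub>3\<close>, the group of all automorphisms of the ternary tree whose sections at the three
  letters lie in \<open>\<Gamma>\<close>. Since \<open>S\<^sub>3\<close> is primitive and not regular on the letters, the stabiliser of a
  letter is a maximal subgroup of \<open>G\<close> that is not normal. Generators of \<open>G\<close> are the rooted
  permutations and the copies of \<open>a\<close> and \<open>t\<close> at the letters.

  Write \<open>L\<^sub>n\<close> for the automorphisms that fix level \<open>n\<close> and have all their sections there in \<open>\<Gamma>''\<close>.
  A commutator computation gives \<open>\<Gamma>' \<times> \<Gamma>' \<times> \<Gamma>' \<le> \<Gamma>'\<close>, so \<open>L\<^sub>n \<le> \<Gamma>\<close>; moreover \<open>\<Gamma>''\<close>, and with it every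
  \<open>L\<^sub>n\<close>, has finite index. As \<open>L\<^sub>n\<close> is generated by its elements that are supported in one subtree,
  this makes \<open>G\<close> a branch group.

  It remains to see that a maximal subgroup \<open>M\<close> of \<open>G\<close> has finite index. If \<open>M L\<^sub>n \<noteq> G\<close> for some
  \<open>n \<ge> 1\<close>, then \<open>M L\<^sub>n = M\<close> contains the subgroup \<open>L\<^sub>n\<close> of finite index. Otherwise \<open>M\<close> is dense for the
  topology given by the \<open>L\<^sub>n\<close>, and the argument of Pervova for torsion GGS groups shows that
  \<open>M = G\<close>, in two steps.

  Going up (\<open>subset_of_secs\<close>): a dense subgroup whose first-level stabiliser projects onto \<open>\<Gamma>\<close> at every letter
  is everything. Among the elements of \<open>M\<close> that are trivial at a second letter, the sections at
  the first one form a normal subgroup \<open>Q\<close> of \<open>\<Gamma>\<close>, and density yields \<open>\<Gamma>' \<le> Q \<Gamma>''\<close>. Then \<open>\<Gamma>' \<le> Q\<close>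
  (\<open>GS'_subset_normal\<close>): if \<open>Q\<close> is not trivial, it contains some \<open>L\<^sub>n\<close>, and the derived series of \<open>\<Gamma>\<close>
  eventually enters \<open>L\<^sub>n\<close>. Commutators of elements that are trivial at the second and at the third letter
  respectively show that \<open>M\<close> contains \<open>L\<^sub>1\<close>, and \<open>M L\<^sub>1 = G\<close>.

  Going down (\<open>dense_eq_GS\<close>): a dense subgroup \<open>H\<close> of \<open>\<Gamma>\<close> is \<open>\<Gamma>\<close>. The projection of its first-level
  stabiliser to a letter is dense again, and by the first step it suffices to prove that it is \<open>\<Gamma>\<close>
  for one letter. By density, \<open>H\<close> contains an element that can be spelled with exponent sum \<open>1\<close> in \<open>t\<close>. The
  sections of a word share the letters \<open>t\<close> of the word among them (\<open>spelled_sections\<close>), so passing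
  to sections shortens such an element until \<open>t\<close> itself is reached; then a projection contains \<open>a\<close>
  and a conjugate of \<open>t\<close>, and in the same way the conjugating element can be shortened until the
  subgroup contains \<open>a\<close> and \<open>t\<close>.
\<close>

section \<open>Groups and commutators\<close>

class multiplicative_group = monoid_mult + inverse +
  assumes left_inverse_mult [simp]: "inverse x * x = 1"
begin

lemma inverse_mult_cancel [simp]: "inverse x * (x * y) = y"
  by (simp add: mult.assoc [symmetric])

lemma right_inverse_mult [simp]: "x * inverse x = 1"
  by (metis inverse_mult_cancel left_inverse_mult mult_1_right)

lemma mult_inverse_cancel [simp]: "x * (inverse x * y) = y"
  by (simp add: mult.assoc [symmetric])

lemma inverse_eqI: "x * y = 1 \<Longrightarrow> inverse x = y"
  by (metis inverse_mult_cancel mult_1_right)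

lemma inverse_of_inverse [simp]: "inverse (inverse x) = x"
  by (simp add: inverse_eqI)

lemma inverse_of_one [simp]: "inverse 1 = 1"
  by (simp add: inverse_eqI)

lemma inverse_of_mult [simp]: "inverse (x * y) = inverse y * inverse x"
  by (rule inverse_eqI) (simp add: mult.assoc)

end

definition subgrp :: "'a::multiplicative_group set \<Rightarrow> bool" where
  "subgrp H \<longleftrightarrow> 1 \<in> H \<and> (\<forall>x\<in>H. \<forall>y\<in>H. x * y \<in> H) \<and> (\<forall>x\<in>H. inverse x \<in> H)"

definition normalised_by :: "'a::multiplicative_group set \<Rightarrow> 'a set \<Rightarrow> bool" where
  "normalised_by N H \<longleftrightarrow> subgrp N \<and> (\<forall>h\<in>H. \<forall>n\<in>N. h * n * inverse h \<in> N)"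

definition comm :: "'a::multiplicative_group \<Rightarrow> 'a \<Rightarrow> 'a" where
  "comm x y = x * y * inverse x * inverse y"

inductive_set commsub :: "'a::multiplicative_group set \<Rightarrow> 'a set" for H where
  one: "1 \<in> commsub H"
| comm: "x \<in> H \<Longrightarrow> y \<in> H \<Longrightarrow> comm x y \<in> commsub H"
| mult: "x \<in> commsub H \<Longrightarrow> y \<in> commsub H \<Longrightarrow> x * y \<in> commsub H"

text \<open>
  Finite index of \<open>N\<close> in \<open>G\<close>, with the representatives of the
  cosets allowed to lie outside \<open>G\<close>: lifting a transversal through sections is
  then possible without correcting the representatives.
\<close>

definition finitely_covered :: "'a::multiplicative_group set \<Rightarrow> 'a set \<Rightarrow> bool" where
  "finitely_covered G N \<longleftrightarrow> (\<exists>F. finite F \<and> (\<forall>g\<in>G. \<exists>f\<in>F. g * inverse f \<in> N))"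

lemma subgrpD:
  assumes "subgrp H"
  shows "1 \<in> H" "x \<in> H \<Longrightarrow> y \<in> H \<Longrightarrow> x * y \<in> H" "x \<in> H \<Longrightarrow> inverse x \<in> H"
  using assms by (auto simp: subgrp_def)

lemma subgrp_power: "subgrp H \<Longrightarrow> x \<in> H \<Longrightarrow> x ^ k \<in> H"
  by (induction k) (auto simp: subgrpD)

lemma subgrp_comm: "subgrp H \<Longrightarrow> x \<in> H \<Longrightarrow> y \<in> H \<Longrightarrow> comm x y \<in> H"
  by (simp add: comm_def subgrpD)

lemma inverse_comm: "inverse (comm x y) = comm y x"
  by (simp add: comm_def mult.assoc)

lemma conj_comm: "g * comm x y * inverse g = comm (g * x * inverse g) (g * y * inverse g)"
  by (simp add: comm_def mult.assoc)

lemma conj_mult: "g * (x * y) * inverse g = (g * x * inverse g) * (g * y * inverse g)"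
  for g :: "'a::multiplicative_group"
  by (simp add: mult.assoc)

lemma subgrp_commsub: "subgrp (commsub H)"
proof -
  have "inverse x \<in> commsub H" if "x \<in> commsub H" for x
    using that by induction (auto simp: inverse_comm intro: commsub.intros)
  then show ?thesis by (auto simp: subgrp_def intro: commsub.intros)
qed

lemma commsub_subset: "subgrp H \<Longrightarrow> commsub H \<subseteq> H"
proof
  fix x assume "subgrp H" "x \<in> commsub H"
  from this(2,1) show "x \<in> H" by induction (auto simp: subgrpD subgrp_comm)
qed

lemma commsub_mono: "H \<subseteq> K \<Longrightarrow> commsub H \<subseteq> commsub K"
proof
  fix x assume "H \<subseteq> K" "x \<in> commsub H"
  from this(2,1) show "x \<in> commsub K" by induction (auto intro: commsub.intros)
qed

lemma normalised_by_commsub: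
  assumes "normalised_by N H" shows "normalised_by (commsub N) H"
proof -
  have "h * x * inverse h \<in> commsub N" if "h \<in> H" "x \<in> commsub N" for h x
    using that(2)
  proof induction
    case (comm x y)
    then show ?case unfolding conj_comm
      using assms that(1) by (auto simp: normalised_by_def intro!: commsub.comm)
  next
    case (mult x y)
    then show ?case unfolding conj_mult by (auto intro: commsub.mult)
  qed (simp add: commsub.one)
  then show ?thesis by (simp add: normalised_by_def subgrp_commsub)
qed

lemma normalised_by_self: "subgrp H \<Longrightarrow> normalised_by H H"
  by (auto simp: normalised_by_def subgrpD)

lemma normalised_by_mono: "normalised_by N H \<Longrightarrow> K \<subseteq> H \<Longrightarrow> normalised_by N K"
  by (auto simp: normalised_by_def)

lemma finitely_covered_mono: "finitely_covered G N \<Longrightarrow> N \<subseteq> K \<Longrightarrow> finitely_covered G K"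
  unfolding finitely_covered_def by (meson subsetD)

definition setmult :: "'a::multiplicative_group set \<Rightarrow> 'a set \<Rightarrow> 'a set" where
  "setmult Q D = {q * d | q d. q \<in> Q \<and> d \<in> D}"

lemma mem_setmult:
  assumes "subgrp Q" shows "x \<in> setmult Q D \<longleftrightarrow> (\<exists>d\<in>D. x * inverse d \<in> Q)"
proof
  assume "\<exists>d\<in>D. x * inverse d \<in> Q"
  then obtain d where d: "d \<in> D" "x * inverse d \<in> Q" by blast
  have "x = (x * inverse d) * d" by (simp add: mult.assoc)
  with d show "x \<in> setmult Q D" unfolding setmult_def by blast
next
  assume "x \<in> setmult Q D"
  then obtain q d where "x = q * d" "q \<in> Q" "d \<in> D" by (auto simp: setmult_def)
  then show "\<exists>d\<in>D. x * inverse d \<in> Q" by (intro bexI[of _ d]) (simp_all add: mult.assoc)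
qed

text \<open>
  Calculations modulo a normal subgroup \<open>N\<close> are done with this relation instead
  of with a quotient group.
\<close>

definition congr :: "'a::multiplicative_group set \<Rightarrow> 'a \<Rightarrow> 'a \<Rightarrow> bool" where
  "congr N x y \<longleftrightarrow> x * inverse y \<in> N"

lemma congr_refl: "subgrp N \<Longrightarrow> congr N x x"
  by (simp add: congr_def subgrpD)

lemma congr_trans:
  assumes "subgrp N" "congr N x y" "congr N y z" shows "congr N x z"
proof -
  have "x * inverse z = (x * inverse y) * (y * inverse z)" by (simp add: mult.assoc)
  then show ?thesis using assms by (simp add: congr_def subgrpD)
qed

lemma congr_mult:
  assumes "normalised_by N G" "congr N x y" "congr N x' y'" "y \<in> G"
  shows "congr N (x * x') (y * y')"
proof -
  have "x * x' * inverse (y * y') = (x * inverse y) * (y * (x' * inverse y') * inverse y)"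
    by (simp add: mult.assoc)
  then show ?thesis
    using assms by (simp only: congr_def normalised_by_def) (blast intro: subgrpD(2))
qed

lemma congr_inverse:
  assumes "normalised_by N G" "congr N x y" "inverse y \<in> G"
  shows "congr N (inverse x) (inverse y)"
proof -
  have "inverse x * inverse (inverse y) = inverse y * inverse (x * inverse y) * inverse (inverse y)"
    by (simp add: mult.assoc)
  then show ?thesis
    using assms by (simp only: congr_def normalised_by_def) (blast intro: subgrpD(3))
qed

text \<open>
  The commutator subgroup of the image in a quotient by \<open>Q\<close> is the image of the
  commutator subgroup.
\<close>

lemma commsub_setmult:
  assumes Q: "normalised_by Q G" and D: "subgrp D" "D \<subseteq> G" and B: "B \<subseteq> setmult Q D"
  shows "commsub B \<subseteq> setmult Q (commsub D)"
proof
  have sQ: "subgrp Q" using Q by (simp add: normalised_by_def)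
  note QD = normalised_by_mono[OF Q D(2)]
  note mem = mem_setmult[OF sQ, folded congr_def]
  fix z assume "z \<in> commsub B"
  then show "z \<in> setmult Q (commsub D)"
  proof induction
    case one
    then show ?case using congr_refl[OF sQ] by (auto simp: mem intro: commsub.one)
  next
    case (comm x y)
    then obtain d e where d: "d \<in> D" "congr Q x d" and e: "e \<in> D" "congr Q y e"
      using subsetD[OF B] unfolding mem by meson
    have "congr Q (comm x y) (comm d e)"
      unfolding comm_def
      by (intro congr_mult[OF QD] congr_inverse[OF QD] d e subgrpD(2,3)[OF D(1)])
    then show ?case using d e by (auto simp: mem intro: commsub.comm)
  next
    case (mult x y)
    then obtain d e where d: "d \<in> commsub D" "congr Q x d"
      and e: "e \<in> commsub D" "congr Q y e"
      unfolding mem by blast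
    have "congr Q (x * y) (d * e)"
      using d e commsub_subset[OF D(1)] by (intro congr_mult[OF QD]) auto
    then show ?case using d e by (auto simp: mem intro: commsub.mult)
  qed
qed

lemma subgrp_commsub_power: "subgrp G \<Longrightarrow> subgrp ((commsub ^^ k) G)"
  by (cases k) (auto simp: subgrp_commsub)

lemma commsub_power_subset: "subgrp G \<Longrightarrow> (commsub ^^ k) G \<subseteq> G"
proof (induction k)
  case (Suc k)
  then show ?case using commsub_subset[OF subgrp_commsub_power[OF Suc.prems, of k]] by simp
qed simp

text \<open>
  In the quotient by \<open>Q\<close> the hypothesis says that the commutator subgroup is
  perfect, hence equal to every later term of the derived series.
\<close>

lemma absorb_commsub_power:
  assumes G: "subgrp G" and Q: "normalised_by Q G"
    and le: "commsub G \<subseteq> setmult Q (commsub (commsub G))"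
  shows "commsub G \<subseteq> setmult Q ((commsub ^^ Suc (Suc k)) G)"
proof (induction k)
  case 0
  then show ?case using le by simp
next
  case (Suc k)
  have sQ: "subgrp Q" using Q by (simp add: normalised_by_def)
  let ?D = "(commsub ^^ Suc (Suc k)) G"
  have 1: "commsub (commsub G) \<subseteq> setmult Q (commsub ?D)"
    by (rule commsub_setmult[OF Q subgrp_commsub_power[OF G] commsub_power_subset[OF G] Suc])
  show ?case
  proof
    fix x assume "x \<in> commsub G"
    then obtain q d where q: "x = q * d" "q \<in> Q" "d \<in> commsub (commsub G)"
      using le unfolding setmult_def by blast
    then obtain q' e where e: "d = q' * e" "q' \<in> Q" "e \<in> commsub ?D"
      using 1 unfolding setmult_def by blast
    have "x = (q * q') * e" using q e by (simp add: mult.assoc)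
    moreover have "q * q' \<in> Q" using subgrpD(2)[OF sQ q(2) e(2)] .
    ultimately show "x \<in> setmult Q ((commsub ^^ Suc (Suc (Suc k))) G)"
      using e unfolding setmult_def by auto
  qed
qed

section \<open>Automorphisms of a regular rooted tree\<close>

text \<open>
  Automorphisms of the tree of all words over a type: compatibility with \<open>take\<close>
  says that prefixes, and thereby the edges of the tree, are preserved.
\<close>

definition tree_perm :: "('x list \<Rightarrow> 'x list) \<Rightarrow> bool" where
  "tree_perm f \<longleftrightarrow> bij f \<and> (\<forall>u. length (f u) = length u) \<and> (\<forall>n u. take n (f u) = f (take n u))"

typedef 'x aut = "{f :: 'x list \<Rightarrow> 'x list. tree_perm f}"
  morphisms act Aut
  by (rule exI[of _ id]) (simp add: tree_perm_def)

lemma tree_perm_act: "tree_perm (act g)"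
  using act[of g] by simp

lemma act_Aut: "tree_perm f \<Longrightarrow> act (Aut f) = f"
  by (simp add: Aut_inverse)

lemma bij_act: "bij (act g)" and length_act [simp]: "length (act g u) = length u"
  and take_act: "take n (act g u) = act g (take n u)"
  using tree_perm_act[of g] by (auto simp: tree_perm_def)

lemma act_eq_iff [simp]: "act g u = act g v \<longleftrightarrow> u = v"
  using bij_act[of g] by (auto simp: bij_def inj_def)

lemma act_Nil [simp]: "act g [] = []"
  using length_act[of g "[]"] by (simp del: length_act)

instantiation aut :: (type) multiplicative_group
begin

definition one_aut :: "'x aut" where "one_aut = Aut id"
definition times_aut :: "'x aut \<Rightarrow> 'x aut \<Rightarrow> 'x aut" where
  "times_aut g h = Aut (act g \<circ> act h)"
definition inverse_aut :: "'x aut \<Rightarrow> 'x aut" where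
  "inverse_aut g = Aut (inv_into UNIV (act g))"
definition divide_aut :: "'x aut \<Rightarrow> 'x aut \<Rightarrow> 'x aut" where
  "divide_aut g h = g * inverse h"

lemma act_one_fun: "act (1 :: 'x aut) = id"
  unfolding one_aut_def by (rule act_Aut) (simp add: tree_perm_def)

lemma act_mult_fun: "act (g * h :: 'x aut) = act g \<circ> act h"
  unfolding times_aut_def
  by (rule act_Aut) (auto simp: tree_perm_def take_act intro: bij_comp bij_act)

lemma act_inverse_fun: "act (inverse g :: 'x aut) = inv_into UNIV (act g)"
  unfolding inverse_aut_def
proof (rule act_Aut)
  have s: "act g (inv_into UNIV (act g) u) = u" for u
    using bij_act[of g] by (simp add: bij_def surj_f_inv_f)
  have l: "length (inv_into UNIV (act g) u) = length u" for u
    by (metis s length_act)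
  have "take n (inv_into UNIV (act g) u) = inv_into UNIV (act g) (take n u)" for n u
    by (metis s act_eq_iff take_act)
  then show "tree_perm (inv_into UNIV (act g))"
    using l by (simp add: tree_perm_def bij_act bij_imp_bij_inv)
qed

instance
proof
  fix g h k :: "'x aut"
  show "g * h * k = g * (h * k)" by (metis act_inject act_mult_fun comp_assoc)
  show "1 * g = g" "g * 1 = g" by (metis act_inject act_mult_fun act_one_fun id_comp comp_id)+
  show "inverse g * g = 1"
    by (metis act_inject act_mult_fun act_one_fun act_inverse_fun bij_act bij_def inv_o_cancel)
qed

end

lemma act_one [simp]: "act 1 u = u"
  by (simp add: act_one_fun)

lemma act_mult [simp]: "act (g * h) u = act g (act h u)"
  by (simp add: act_mult_fun)

lemma act_inverse_cancel [simp]: "act (inverse g) (act g u) = u" "act g (act (inverse g) u) = u"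
  by (metis act_mult act_one left_inverse_mult right_inverse_mult)+

definition root :: "'x aut \<Rightarrow> 'x \<Rightarrow> 'x" where
  "root g x = hd (act g [x])"

definition sec :: "'x aut \<Rightarrow> 'x \<Rightarrow> 'x aut" where
  "sec g x = Aut (\<lambda>w. tl (act g (x # w)))"

lemma act_Cons_hd: "act g (x # w) = root g x # tl (act g (x # w))"
proof -
  have "act g (x # w) \<noteq> []" by (metis length_act length_0_conv list.distinct(1))
  then have "hd (act g (x # w)) = hd (take 1 (act g (x # w)))" by (cases "act g (x # w)") auto
  also have "\<dots> = root g x" by (simp add: take_act root_def)
  finally show ?thesis using \<open>act g (x # w) \<noteq> []\<close> by (metis list.collapse)
qed

lemma act_Cons [simp]: "act g (x # w) = root g x # act (sec g x) w"
proof -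
  let ?f = "\<lambda>w. tl (act g (x # w))"
  have l: "length (?f w) = length w" for w by simp
  have t: "take n (?f w) = ?f (take n w)" for n w
  proof -
    have "root g x # take n (?f w) = take (Suc n) (act g (x # w))"
      by (subst act_Cons_hd) simp
    also have "\<dots> = root g x # ?f (take n w)" by (simp add: take_act) (rule act_Cons_hd)
    finally show ?thesis by simp
  qed
  have i: "inj ?f"
  proof (rule injI)
    fix v w assume "?f v = ?f w"
    then have "root g x # ?f v = root g x # ?f w" by simp
    then have "act g (x # v) = act g (x # w)" by (simp only: act_Cons_hd[symmetric])
    then show "v = w" by simp
  qed
  have s: "surj ?f"
  proof (rule surjI)
    fix v
    let ?u = "act (inverse g) (root g x # v)"
    obtain y w where u: "?u = y # w" by (metis act_Cons_hd)
    have g: "act g (y # w) = root g x # v" using u by (metis act_inverse_cancel(2))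
    then have "take 1 (act g (y # w)) = take 1 (act g [x])"
      by (subst (2) act_Cons_hd) simp
    then have "y = x" by (simp add: take_act)
    then show "?f (tl ?u) = v" using g u by simp
  qed
  have "tree_perm ?f" unfolding tree_perm_def using i s l t by (simp add: bij_def)
  then have "act (sec g x) = ?f" unfolding sec_def by (rule act_Aut)
  then show ?thesis using act_Cons_hd[of g x w] by metis
qed

lemma aut_eqI: "(\<And>x. root g x = root h x) \<Longrightarrow> (\<And>x. sec g x = sec h x) \<Longrightarrow> g = h"
proof -
  assume "\<And>x. root g x = root h x" "\<And>x. sec g x = sec h x"
  then have "act g u = act h u" for u by (cases u) auto
  then show ?thesis by (simp add: fun_eq_iff flip: act_inject)
qed

lemma aut_eq_actI: "(\<And>u. act g u = act h u) \<Longrightarrow> g = h"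
  by (simp add: fun_eq_iff flip: act_inject)

lemma root_one [simp]: "root 1 x = x"
  using act_Cons[of 1 x "[]"] by (simp del: act_Cons)

lemma sec_one [simp]: "sec 1 x = 1"
proof (rule aut_eq_actI)
  fix u :: "'a list"
  show "act (sec 1 x) u = act 1 u"
    using act_Cons[of 1 x u] act_one[of "x # u"] act_one[of u] by (metis list.inject)
qed

lemma root_mult [simp]: "root (g * h) x = root g (root h x)"
  using act_mult[of g h "[x]"] by simp

lemma sec_mult [simp]: "sec (g * h) x = sec g (root h x) * sec h x"
proof (rule aut_eq_actI)
  fix u
  have "act (g * h) (x # u) = act g (act h (x # u))" by (rule act_mult)
  then show "act (sec (g * h) x) u = act (sec g (root h x) * sec h x) u" by simp
qed

lemma root_inverse_cancel [simp]: "root (inverse g) (root g x) = x" "root g (root (inverse g) x) = x"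
  by (metis root_mult root_one left_inverse_mult right_inverse_mult)+

lemma root_eq_iff [simp]: "root g x = root g y \<longleftrightarrow> x = y"
  by (metis root_inverse_cancel(1))

lemma sec_inverse: "sec (inverse g) x = inverse (sec g (root (inverse g) x))"
proof -
  have "sec g (root (inverse g) x) * sec (inverse g) x = 1"
    by (metis sec_mult sec_one right_inverse_mult)
  then show ?thesis by (metis inverse_eqI)
qed

lemma root_inverse_id: "(\<And>x. root g x = x) \<Longrightarrow> root (inverse g) x = x"
  by (metis root_inverse_cancel(1))

lemma bij_root: "bij (root g)"
  by (rule o_bij[of "root (inverse g)"]) (auto simp: fun_eq_iff)

definition mk :: "('x \<Rightarrow> 'x) \<Rightarrow> ('x \<Rightarrow> 'x aut) \<Rightarrow> 'x aut" where
  "mk p s = Aut (\<lambda>u. case u of [] \<Rightarrow> [] | x # w \<Rightarrow> p x # act (s x) w)"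

lemma act_mk:
  assumes "bij p"
  shows "act (mk p s) (x # w) = p x # act (s x) w"
proof -
  let ?f = "\<lambda>u. case u of [] \<Rightarrow> [] | x # w \<Rightarrow> p x # act (s x) w"
  \<comment> \<open>\<open>?g\<close> below is the explicit inverse\<close>
  let ?q = "inv_into UNIV p"
  let ?g = "\<lambda>u. case u of [] \<Rightarrow> [] | x # w \<Rightarrow> ?q x # act (inverse (s (?q x))) w"
  have q: "?q (p x) = x" "p (?q x) = x" for x
    using assms by (auto simp: bij_def surj_f_inv_f)
  have "bij ?f"
    by (rule o_bij[of ?g]) (auto simp: fun_eq_iff q split: list.splits)
  moreover have "length (?f u) = length u" for u by (cases u) auto
  moreover have "take n (?f u) = ?f (take n u)" for n u
    by (cases u; cases n) (auto simp: take_act)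
  ultimately have "tree_perm ?f" by (simp add: tree_perm_def)
  then show ?thesis by (simp add: mk_def act_Aut)
qed

lemma root_mk [simp]: "bij p \<Longrightarrow> root (mk p s) = p"
  by (simp add: fun_eq_iff root_def act_mk del: act_Cons)

lemma sec_mk [simp]: "bij p \<Longrightarrow> sec (mk p s) = s"
proof (rule ext, rule aut_eq_actI)
  fix x u assume "bij p"
  then show "act (sec (mk p s) x) u = act (s x) u"
    using act_mk[of p s x u] by simp
qed

definition put :: "'x \<Rightarrow> 'x aut \<Rightarrow> 'x aut" where
  "put x z = mk id (\<lambda>y. if y = x then z else 1)"

lemma root_put [simp]: "root (put x z) y = y"
  by (simp add: put_def)

lemma sec_put: "sec (put x z) y = (if y = x then z else 1)"
  by (simp add: put_def)

lemma sec_put_same [simp]: "sec (put x z) x = z"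
  by (simp add: sec_put)

lemma put_one [simp]: "put x 1 = 1"
  by (rule aut_eqI) (auto simp: sec_put)

lemma put_mult: "put x (y * z) = put x y * put x z"
  by (rule aut_eqI) (auto simp: sec_put)

lemma put_inverse: "put x (inverse z) = inverse (put x z)"
  by (metis put_mult put_one right_inverse_mult inverse_eqI)

lemma conj_put: "g * put x z * inverse g = put (root g x) (sec g x * z * inverse (sec g x))"
proof (rule aut_eqI)
  fix y
  have *: "root (inverse g) y = x \<longleftrightarrow> y = root g x" by (metis root_inverse_cancel)
  show "sec (g * put x z * inverse g) y = sec (put (root g x) (sec g x * z * inverse (sec g x))) y"
    by (auto simp: sec_put sec_inverse * mult.assoc)
qed simp

lemma put_commute: "x \<noteq> y \<Longrightarrow> put x z * put y w = put y w * put x z"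
  by (rule aut_eqI) (auto simp: sec_put)

primrec sec_word :: "'x aut \<Rightarrow> 'x list \<Rightarrow> 'x aut" where
  "sec_word g [] = g"
| "sec_word g (x # u) = sec_word (sec g x) u"

primrec put_word :: "'x list \<Rightarrow> 'x aut \<Rightarrow> 'x aut" where
  "put_word [] z = z"
| "put_word (x # u) z = put x (put_word u z)"

lemma put_word_mult: "put_word u (y * z) = put_word u y * put_word u z"
  by (induction u) (auto simp: put_mult)

lemma put_word_one [simp]: "put_word u 1 = 1"
  by (induction u) auto

lemma put_word_inverse: "put_word u (inverse z) = inverse (put_word u z)"
  by (metis put_word_mult put_word_one right_inverse_mult inverse_eqI)

lemma put_word_comm: "put_word u (comm y z) = comm (put_word u y) (put_word u z)"
  by (simp add: comm_def put_word_mult put_word_inverse)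

lemma conj_put_word: "g * put_word u z * inverse g = put_word (act g u) (sec_word g u * z * inverse (sec_word g u))"
  by (induction u arbitrary: g) (simp_all add: conj_put)

lemma put_word_commute:
  "length u = length v \<Longrightarrow> u \<noteq> v \<Longrightarrow> put_word u z * put_word v w = put_word v w * put_word u z"
proof (induction u v rule: list_induct2)
  case (Cons x u y v)
  then show ?case by (cases "x = y") (auto simp: put_commute simp flip: put_mult)
qed simp

text \<open>
  For a group \<open>K\<close> this is the direct product of the copies of \<open>K\<close>
  at the vertices of level \<open>n\<close>.
\<close>

primrec layer :: "nat \<Rightarrow> 'x aut set \<Rightarrow> 'x aut set" where
  "layer 0 K = K"
| "layer (Suc n) K = {g. (\<forall>x. root g x = x) \<and> (\<forall>x. sec g x \<in> layer n K)}"

lemma layer_Suc': "layer (Suc n) K = layer n (layer 1 K)"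
  by (induction n) auto

lemma layer_mono: "K \<subseteq> K' \<Longrightarrow> layer n K \<subseteq> layer n K'"
  by (induction n) auto

lemma subgrp_layer: "subgrp K \<Longrightarrow> subgrp (layer n K)"
  by (induction n) (auto simp: subgrp_def sec_inverse root_inverse_id)

lemma layer_fixes: "g \<in> layer n K \<Longrightarrow> length u \<le> n \<Longrightarrow> act g u = u"
proof (induction n arbitrary: g u)
  case (Suc n)
  then show ?case by (cases u) auto
qed simp

lemma sec_comm:
  assumes "\<And>x. root g x = x" "\<And>x. root h x = x"
  shows "sec (comm g h) x = comm (sec g x) (sec h x)" "root (comm g h) x = x"
  using assms by (simp_all add: comm_def sec_inverse root_inverse_id)

lemma commsub_layer1: "commsub (layer 1 K) \<subseteq> layer 1 (commsub K)"
proof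
  fix g assume "g \<in> commsub (layer 1 K)"
  then show "g \<in> layer 1 (commsub K)"
  proof induction
    case (comm g h)
    then show ?case by (simp add: sec_comm commsub.comm)
  qed (simp_all add: commsub.one commsub.mult)
qed

text \<open>
  Only elements that fix the whole first level are projected. For the full wreath product
  the stabiliser of the single letter \<open>x\<close> would be larger, and the projections
  at two letters could not be compared.
\<close>

definition secs :: "'x aut set \<Rightarrow> 'x \<Rightarrow> 'x aut set" where
  "secs H x = {sec h x | h. h \<in> H \<and> (\<forall>y. root h y = y)}"

lemma secsI: "h \<in> H \<Longrightarrow> (\<And>y. root h y = y) \<Longrightarrow> sec h x \<in> secs H x"
  by (auto simp: secs_def)

lemma subgrp_secs:
  assumes "subgrp H" shows "subgrp (secs H x)"
  unfolding subgrp_def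
proof (intro conjI ballI)
  show "1 \<in> secs H x" using secsI[of 1 H x] subgrpD(1)[OF assms] by simp
  fix a assume "a \<in> secs H x"
  then obtain h where h: "a = sec h x" "h \<in> H" "\<And>y. root h y = y" by (auto simp: secs_def)
  show "inverse a \<in> secs H x"
    using secsI[of "inverse h" H x] h subgrpD(3)[OF assms] by (simp add: sec_inverse root_inverse_id)
  fix b assume "b \<in> secs H x"
  then obtain k where k: "b = sec k x" "k \<in> H" "\<And>y. root k y = y" by (auto simp: secs_def)
  show "a * b \<in> secs H x"
    using secsI[of "h * k" H x] h k subgrpD(2)[OF assms] by simp
qed

section \<open>The Gupta-Sidki 3-group\<close>

lemma letter_cases: obtains "(x :: 3) = 0" | "x = 1" | "x = 2"
proof (cases x rule: bit1_cases)
  case (of_int z)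
  then have "z = 0 \<or> z = 1 \<or> z = 2" by auto
  then show ?thesis using of_int that by auto
qed

lemma letter_numerals: "(-1 :: 3) = 2" "(-2 :: 3) = 1" "(3 :: 3) = 0" "(4 :: 3) = 1"
  by simp_all

definition gs_a :: "3 aut" where "gs_a = mk (\<lambda>x. x + 1) (\<lambda>_. 1)"

lemma bij_add_letter: "bij (\<lambda>x :: 3. x + c)"
  by (rule o_bij[of "\<lambda>x. x - c"]) auto

lemma root_gs_a [simp]: "root gs_a x = x + 1" and sec_gs_a [simp]: "sec gs_a x = 1"
  by (simp_all add: gs_a_def bij_add_letter)

lemma gs_a_cube: "gs_a * (gs_a * gs_a) = 1"
  by (rule aut_eqI) (auto simp: add.assoc)

lemma inverse_gs_a: "inverse gs_a = gs_a * gs_a"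
  by (rule inverse_eqI) (rule gs_a_cube)

lemma root_inverse_gs_a [simp]: "root (inverse gs_a) x = x - 1"
  by (metis root_gs_a root_inverse_cancel(1) diff_add_cancel)

lemma sec_inverse_gs_a [simp]: "sec (inverse gs_a) x = 1"
  by (simp add: sec_inverse)

text \<open>
  The action of the generator \<open>t\<close>, whose section at the letter \<open>0\<close>
  is \<open>t\<close> itself.
\<close>

primrec directed :: "3 list \<Rightarrow> 3 list" where
  "directed [] = []"
| "directed (x # w) =
     x # (if x = 0 then directed w else act (if x = 1 then gs_a else inverse gs_a) w)"

lemma gs_a_cube_act: "act gs_a (act gs_a (act gs_a u)) = u"
  using gs_a_cube by (metis act_mult act_one)

lemma tree_perm_directed: "tree_perm directed"
proof -
  have c: "directed (directed (directed u)) = u" for u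
    by (induction u) (auto simp: gs_a_cube_act inverse_gs_a)
  have "bij directed"
    by (rule o_bij[of "directed \<circ> directed"]) (auto simp: fun_eq_iff c)
  moreover have "length (directed u) = length u" for u
    by (induction u) auto
  moreover have "take n (directed u) = directed (take n u)" for n u
    by (induction u arbitrary: n) (auto simp: take_Cons take_act split: nat.splits)
  ultimately show ?thesis by (simp add: tree_perm_def)
qed

definition gs_t :: "3 aut" where "gs_t = Aut directed"

lemma act_gs_t: "act gs_t (x # w) = x # act (if x = 0 then gs_t else if x = 1 then gs_a else inverse gs_a) w"
  by (simp add: gs_t_def act_Aut tree_perm_directed)

lemma root_gs_t [simp]: "root gs_t x = x"
  using act_gs_t[of x "[]"] by simp

lemma sec_gs_t: "sec gs_t x = (if x = 0 then gs_t else if x = 1 then gs_a else inverse gs_a)"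
  by (rule aut_eq_actI) (use act_gs_t[of x] in simp)

lemma gs_t_cube: "gs_t * (gs_t * gs_t) = 1"
proof (rule aut_eq_actI)
  show "act (gs_t * (gs_t * gs_t)) u = act 1 u" for u
    by (induction u) (auto simp: sec_gs_t gs_a_cube_act inverse_gs_a)
qed

lemma inverse_gs_t: "inverse gs_t = gs_t * gs_t"
  by (rule inverse_eqI) (rule gs_t_cube)

lemma root_inverse_gs_t [simp]: "root (inverse gs_t) x = x"
  by (simp add: root_inverse_id)

lemma sec_inverse_gs_t: "sec (inverse gs_t) x = inverse (sec gs_t x)"
  by (simp add: sec_inverse)

text \<open>
  \<open>spelled g i j n\<close>: the automorphism \<open>g\<close> is given by some word in
  \<open>a\<close> and \<open>t\<close> with exponent sums \<open>i\<close> and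
  \<open>j\<close> modulo 3 and with \<open>n\<close> occurrences of \<open>t\<close> or its
  inverse. Occurrences of \<open>a\<close> are not counted, so the length does not grow
  under sections. It is a relation because these numbers belong to the word, and different
  words may represent \<open>g\<close>.
\<close>

inductive spelled :: "3 aut \<Rightarrow> 3 \<Rightarrow> 3 \<Rightarrow> nat \<Rightarrow> bool" where
  one: "spelled 1 0 0 0"
| a: "spelled g i j n \<Longrightarrow> spelled (gs_a * g) (i + 1) j n"
| t: "spelled g i j n \<Longrightarrow> spelled (gs_t * g) i (j + 1) (Suc n)"
| t': "spelled g i j n \<Longrightarrow> spelled (inverse gs_t * g) i (j - 1) (Suc n)"

lemma spelled_a':
  assumes "spelled g i j n" shows "spelled (inverse gs_a * g) (i - 1) j n"
proof -
  have "i + 1 + 1 = i - 1" by (cases i rule: letter_cases) auto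
  with spelled.a[OF spelled.a[OF assms]] show ?thesis by (simp only: inverse_gs_a mult.assoc)
qed

lemma spelled_gs_a: "spelled gs_a 1 0 0" and spelled_gs_t: "spelled gs_t 0 1 1"
  and spelled_inverse_gs_a: "spelled (inverse gs_a) (-1) 0 0"
  and spelled_inverse_gs_t: "spelled (inverse gs_t) 0 (-1) 1"
  using spelled.a[OF spelled.one] spelled.t[OF spelled.one] spelled.t'[OF spelled.one]
    spelled_a'[OF spelled.one] by auto

lemma spelled_mult:
  assumes "spelled g i j n" "spelled h i' j' n'"
  shows "spelled (g * h) (i + i') (j + j') (n + n')"
  using assms
proof induction
  case (a g i j n)
  then show ?case using spelled.a[of "g * h" "i + i'"] by (simp add: mult.assoc ac_simps)
next
  case (t g i j n)
  then show ?case using spelled.t[of "g * h" "i + i'" "j + j'"] by (simp add: mult.assoc ac_simps)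
next
  case (t' g i j n)
  then show ?case using spelled.t'[of "g * h" "i + i'" "j + j'"] by (simp add: mult.assoc algebra_simps)
qed simp

lemma spelled_inverse: "spelled g i j n \<Longrightarrow> spelled (inverse g) (- i) (- j) n"
proof (induction rule: spelled.induct)
  case one
  then show ?case using spelled.one by simp
next
  case (a g i j n)
  then show ?case using spelled_mult[OF a.IH spelled_inverse_gs_a] by simp
next
  case (t g i j n)
  then show ?case using spelled_mult[OF t.IH spelled_inverse_gs_t] by simp
next
  case (t' g i j n)
  then show ?case using spelled_mult[OF t'.IH spelled_gs_t] by (simp add: algebra_simps)
qed

lemma root_spelled: "spelled g i j n \<Longrightarrow> root g x = x + i"
  by (induction arbitrary: x rule: spelled.induct) (auto simp: ac_simps)

lemma spelled_0: "spelled g i j n \<Longrightarrow> n = 0 \<Longrightarrow> j = 0 \<and> (\<exists>k. of_nat k = i \<and> g = gs_a ^ k)"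
proof (induction rule: spelled.induct)
  case one
  then show ?case by (auto intro: exI[of _ 0])
next
  case (a g i j n)
  then obtain k where "of_nat k = i" "g = gs_a ^ k" by auto
  then show ?case using a by (auto intro!: exI[of _ "Suc k"])
qed auto

text \<open>
  The key to every length argument. Each occurrence of \<open>t\<close> in the word
  contributes \<open>t\<close> to the section at one letter, and \<open>a\<close> and its
  inverse to the two other ones. With \<open>J y\<close> and \<open>N y\<close> the exponent
  sum and the number of the \<open>t\<close> that go to position \<open>y\<close>, the
  exponent sum of \<open>a\<close> there is \<open>J (y - 1) - J (y + 1)\<close>. Positions
  are counted after applying \<open>g\<close>, so that multiplication by \<open>a\<close>
  from the left only rotates them. If all \<open>t\<close> go to one position, then nothing
  separates them in the section there, which is therefore a power of \<open>t\<close>.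
\<close>

lemma spelled_sections:
  assumes "spelled g i j n"
  obtains J N where "\<And>y. spelled (sec g (y - i)) (J (y - 1) - J (y + 1)) (J y) (N y)"
    "J 0 + J 1 + J 2 = j" "N 0 + N 1 + N 2 = n"
    "\<And>y. N y = n \<Longrightarrow> \<exists>k. of_nat k = j \<and> sec g (y - i) = gs_t ^ k"
proof -
  have "\<exists>J N. (\<forall>y. spelled (sec g (y - i)) (J (y - 1) - J (y + 1)) (J y) (N y)) \<and>
    J 0 + J 1 + J 2 = j \<and> N 0 + N 1 + N 2 = n \<and>
    (\<forall>y. N y = n \<longrightarrow> (\<exists>k. of_nat k = j \<and> sec g (y - i) = gs_t ^ k))"
    using assms
  proof induction
    case one
    show ?case
      by (rule exI[of _ "\<lambda>_. 0"], rule exI[of _ "\<lambda>_. 0"]) (auto intro: spelled.one exI[of _ 0])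
  next
    case (a g i j n)
    then obtain J N where JN: "\<And>y. spelled (sec g (y - i)) (J (y - 1) - J (y + 1)) (J y) (N y)"
      "J 0 + J 1 + J 2 = j" "N 0 + N 1 + N 2 = n"
      "\<And>y. N y = n \<Longrightarrow> \<exists>k. of_nat k = j \<and> sec g (y - i) = gs_t ^ k" by blast
    have s: "sec (gs_a * g) (y - (i + 1)) = sec g (y - 1 - i)" for y
      by (simp add: algebra_simps)
    show ?case unfolding s
      using JN(1)[of "y - 1" for y] JN(2-4)
      by (intro exI[of _ "\<lambda>y. J (y - 1)"] exI[of _ "\<lambda>y. N (y - 1)"]) (auto simp: ac_simps letter_numerals)
  next
    case (t g i j n)
    then obtain J N where JN: "\<And>y. spelled (sec g (y - i)) (J (y - 1) - J (y + 1)) (J y) (N y)"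
      "J 0 + J 1 + J 2 = j" "N 0 + N 1 + N 2 = n"
      "\<And>y. N y = n \<Longrightarrow> \<exists>k. of_nat k = j \<and> sec g (y - i) = gs_t ^ k" by blast
    have s: "sec (gs_t * g) (y - i) = sec gs_t y * sec g (y - i)" for y
      using t by (simp add: root_spelled)
    let ?J = "J(0 := J 0 + 1)" and ?N = "N(0 := Suc (N 0))"
    have 1: "spelled (sec gs_t y * sec g (y - i)) (?J (y - 1) - ?J (y + 1)) (?J y) (?N y)" for y
    proof (cases y rule: letter_cases)
      case 1
      then show ?thesis using spelled.t[OF JN(1)[of 0]] by (simp add: sec_gs_t)
    next
      case 2
      then show ?thesis using spelled.a[OF JN(1)[of 1]] by (simp add: sec_gs_t algebra_simps)
    next
      case 3
      then show ?thesis using spelled_a'[OF JN(1)[of 2]] by (simp add: sec_gs_t algebra_simps letter_numerals)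
    qed
    have 2: "\<exists>k. of_nat k = j + 1 \<and> sec gs_t y * sec g (y - i) = gs_t ^ k" if "?N y = Suc n" for y
    proof -
      have "y = 0" using that JN(3) by (cases y rule: letter_cases) auto
      then obtain k where "of_nat k = j" "sec g (y - i) = gs_t ^ k" using JN(4)[of y] \<open>?N y = Suc n\<close> by auto
      then show ?thesis using \<open>y = 0\<close> by (intro exI[of _ "Suc k"]) (simp add: sec_gs_t add.commute)
    qed
    show ?case unfolding s using 1 2 JN(2,3)
      by (intro exI[of _ ?J] exI[of _ ?N]) (auto simp: ac_simps)
  next
    case (t' g i j n)
    then obtain J N where JN: "\<And>y. spelled (sec g (y - i)) (J (y - 1) - J (y + 1)) (J y) (N y)"
      "J 0 + J 1 + J 2 = j" "N 0 + N 1 + N 2 = n"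
      "\<And>y. N y = n \<Longrightarrow> \<exists>k. of_nat k = j \<and> sec g (y - i) = gs_t ^ k" by blast
    have s: "sec (inverse gs_t * g) (y - i) = inverse (sec gs_t y) * sec g (y - i)" for y
      using t' by (simp add: root_spelled sec_inverse_gs_t)
    let ?J = "J(0 := J 0 - 1)" and ?N = "N(0 := Suc (N 0))"
    have 1: "spelled (inverse (sec gs_t y) * sec g (y - i)) (?J (y - 1) - ?J (y + 1)) (?J y) (?N y)" for y
    proof (cases y rule: letter_cases)
      case 1
      then show ?thesis using spelled.t'[OF JN(1)[of 0]] by (simp add: sec_gs_t)
    next
      case 2
      then show ?thesis using spelled_a'[OF JN(1)[of 1]] by (simp add: sec_gs_t algebra_simps)
    next
      case 3
      then show ?thesis using spelled.a[OF JN(1)[of 2]] by (simp add: sec_gs_t algebra_simps letter_numerals)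
    qed
    have 2: "\<exists>k. of_nat k = j - 1 \<and> inverse (sec gs_t y) * sec g (y - i) = gs_t ^ k" if "?N y = Suc n" for y
    proof -
      have "y = 0" using that JN(3) by (cases y rule: letter_cases) auto
      then obtain k where k: "of_nat k = j" "sec g (y - i) = gs_t ^ k" using JN(4)[of y] \<open>?N y = Suc n\<close> by auto
      have "j + 2 = j - 1" by (cases j rule: letter_cases) auto
      then show ?thesis using \<open>y = 0\<close> k
        by (intro exI[of _ "Suc (Suc k)"]) (simp add: sec_gs_t inverse_gs_t mult.assoc add.commute)
    qed
    show ?case unfolding s using 1 2 JN(2,3)
      by (intro exI[of _ ?J] exI[of _ ?N]) (auto simp: algebra_simps)
  qed
  then show ?thesis using that by blast
qed

definition GS :: "3 aut set" where "GS = {g. \<exists>i j n. spelled g i j n}"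

lemma GSE: assumes "g \<in> GS" obtains i j n where "spelled g i j n"
  using assms by (auto simp: GS_def)

lemma GSI: "spelled g i j n \<Longrightarrow> g \<in> GS"
  by (auto simp: GS_def)

lemma subgrp_GS: "subgrp GS"
  unfolding subgrp_def by (meson GSE GSI spelled.one spelled_inverse spelled_mult)

lemma gs_a_GS: "gs_a \<in> GS" and gs_t_GS: "gs_t \<in> GS"
  by (rule GSI[OF spelled_gs_a], rule GSI[OF spelled_gs_t])

lemma GS_least:
  assumes "subgrp H" "gs_a \<in> H" "gs_t \<in> H" shows "GS \<subseteq> H"
proof
  fix g assume "g \<in> GS"
  then obtain i j n where "spelled g i j n" by (rule GSE)
  then show "g \<in> H" by induction (use assms in \<open>simp_all add: subgrpD\<close>)
qed

lemma sec_GS: "g \<in> GS \<Longrightarrow> sec g x \<in> GS"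
proof (elim GSE)
  fix i j n assume g: "spelled g i j n"
  obtain J N where "\<And>y. spelled (sec g (y - i)) (J (y - 1) - J (y + 1)) (J y) (N y)"
    by (rule spelled_sections[OF g]) blast
  from this[of "x + i"] show "sec g x \<in> GS" by (auto intro: GSI)
qed

text \<open>
  The conjugates of \<open>t\<close> by the powers of \<open>a\<close>, indexed by the
  letter at which the section is \<open>t\<close>.
\<close>

definition tau :: "3 \<Rightarrow> 3 aut" where
  "tau c = mk id (\<lambda>y. if y = c then gs_t else if y = c + 1 then gs_a else inverse gs_a)"

lemma root_tau [simp]: "root (tau c) x = x"
  and sec_tau: "sec (tau c) y = (if y = c then gs_t else if y = c + 1 then gs_a else inverse gs_a)"
  by (simp_all add: tau_def)

lemma tau_0: "tau 0 = gs_t"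
  by (rule aut_eqI) (auto simp: sec_tau sec_gs_t)

lemma tau_Suc: "gs_a * tau c * inverse gs_a = tau (c + 1)"
  by (rule aut_eqI) (auto simp: sec_tau)

lemma tau_GS: "tau c \<in> GS"
proof -
  have s: "tau (c + 1) \<in> GS" if "tau c \<in> GS" for c
    using that unfolding tau_Suc[symmetric] by (intro subgrpD[OF subgrp_GS] gs_a_GS)
  have "tau 0 \<in> GS" by (simp add: tau_0 gs_t_GS)
  moreover from s[OF this] have "tau 1 \<in> GS" by simp
  moreover from s[OF this] have "tau 2 \<in> GS" by simp
  ultimately show ?thesis by (cases c rule: letter_cases) auto
qed

text \<open>
  The group is self-replicating: the sections of the conjugates of \<open>t\<close> at a
  fixed letter are \<open>t\<close>, \<open>a\<close> and the inverse of \<open>a\<close>.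
\<close>

lemma secs_GS: "secs GS x = GS"
proof
  show "secs GS x \<subseteq> GS" by (auto simp: secs_def sec_GS)
  have "gs_t \<in> secs GS x" using secsI[OF tau_GS[of x] root_tau, of x] by (simp add: sec_tau)
  moreover have "gs_a \<in> secs GS x"
    using secsI[OF tau_GS[of "x - 1"] root_tau, of x] by (simp add: sec_tau)
  ultimately show "GS \<subseteq> secs GS x"
    by (intro GS_least subgrp_secs subgrp_GS)
qed

lemma GS_lift:
  assumes "g \<in> GS" obtains h where "h \<in> GS" "\<And>y. root h y = y" "sec h x = g"
proof -
  have "g \<in> secs GS x" using assms by (simp add: secs_GS)
  then show ?thesis using that by (auto simp: secs_def)
qed

lemma GS_root_transitive: obtains g where "g \<in> GS" "root g x = y" "\<And>z. sec g z = 1"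
proof -
  have "\<exists>g\<in>GS. root g x = x + c \<and> (\<forall>z. sec g z = 1)" for c
    by (cases c rule: letter_cases)
       (use subgrpD(1,2)[OF subgrp_GS] gs_a_GS in \<open>auto intro: bexI[of _ 1] bexI[of _ gs_a] bexI[of _ "gs_a * gs_a"] simp: add.assoc\<close>)
  from this[of "y - x"] show ?thesis using that by auto
qed

lemma GS_transitive: "length u = length v \<Longrightarrow> \<exists>g\<in>GS. act g u = v"
proof (induction u v rule: list_induct2)
  case Nil
  then show ?case using subgrpD(1)[OF subgrp_GS] by auto
next
  case (Cons x u y v)
  then obtain g where g: "g \<in> GS" "act g u = v" by blast
  obtain h where h: "h \<in> GS" "\<And>y. root h y = y" "sec h y = g" using GS_lift[OF g(1)] by metis
  obtain r where r: "r \<in> GS" "root r x = y" "\<And>z. sec r z = 1" using GS_root_transitive by blast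
  have "act (h * r) (x # u) = y # v" using g h r by simp
  then show ?case using h r subgrpD(2)[OF subgrp_GS] by metis
qed

section \<open>Branching over the commutator subgroup\<close>

lemma comm_mult_left: "comm (x * y) h = (x * comm y h * inverse x) * comm x h"
  and comm_inverse_left: "comm (inverse x) h = inverse x * inverse (comm x h) * inverse (inverse x)"
  for x :: "'a::multiplicative_group"
  by (simp_all add: comm_def mult.assoc)

lemma comm_self [simp]: "comm x x = 1"
  by (simp add: comm_def mult.assoc)

lemma comm_one [simp]: "comm x 1 = 1" "comm 1 x = 1"
  by (simp_all add: comm_def)

lemma normalised_byD:
  assumes "normalised_by N H"
  shows "subgrp N" "h \<in> H \<Longrightarrow> n \<in> N \<Longrightarrow> h * n * inverse h \<in> N"
  using assms by (auto simp: normalised_by_def)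

text \<open>
  In the quotient by \<open>N\<close> the two generators commute, so the quotient is
  abelian.
\<close>

lemma commsub_GS_least:
  assumes N: "normalised_by N GS" and at: "comm gs_a gs_t \<in> N"
  shows "commsub GS \<subseteq> N"
proof -
  note sN = normalised_byD(1)[OF N] and nN = normalised_byD(2)[OF N]
  note G = subgrpD[OF subgrp_GS] gs_a_GS gs_t_GS
  have ta: "comm gs_t gs_a \<in> N" using subgrpD(3)[OF sN at] by (simp add: inverse_comm)
  have gen: "comm g s \<in> N" if s: "s \<in> GS" "comm gs_a s \<in> N" "comm gs_t s \<in> N" and g: "g \<in> GS" for g s
  proof -
    have "comm (inverse gs_t) s \<in> N"
      unfolding comm_inverse_left by (intro nN subgrpD(3)[OF sN] G s)
    note s = s this
    obtain i j n where "spelled g i j n" using g by (rule GSE)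
    then show ?thesis
    proof induction
      case one
      then show ?case using subgrpD(1)[OF sN] by (simp add: comm_def)
    qed (unfold comm_mult_left, (intro subgrpD(2)[OF sN] nN G s; assumption)+)
  qed
  have one: "comm x x \<in> N" for x by (simp add: subgrpD(1)[OF sN])
  have "comm gs_a g \<in> N" "comm gs_t g \<in> N" if "g \<in> GS" for g
    using subgrpD(3)[OF sN gen[OF G(4) one ta that]] subgrpD(3)[OF sN gen[OF G(5) at one that]]
    by (simp_all add: inverse_comm)
  then have c: "comm h g \<in> N" if "g \<in> GS" "h \<in> GS" for g h
    using gen[OF that(1) _ _ that(2)] that by blast
  show ?thesis
  proof
    fix x assume "x \<in> commsub GS"
    then show "x \<in> N" by induction (use c sN in \<open>simp_all add: subgrpD\<close>)
  qed
qed

lemma normalised_by_commsub_GS: "normalised_by (commsub GS) GS"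
  by (intro normalised_by_commsub normalised_by_self subgrp_GS)

lemma normalised_by_commsub_commsub_GS: "normalised_by (commsub (commsub GS)) GS"
  by (intro normalised_by_commsub normalised_by_commsub_GS)

text \<open>
  What a normal subgroup \<open>N\<close> contains at the letter \<open>0\<close>. Since the
  group is self-replicating and rotates the letters, this is again normal, and the same
  elements occur at the other letters.
\<close>

definition pull :: "3 aut set \<Rightarrow> 3 aut set" where
  "pull N = {z \<in> GS. put 0 z \<in> N}"

lemma normalised_by_pull:
  assumes "normalised_by N GS" shows "normalised_by (pull N) GS"
proof -
  note sN = normalised_byD(1)[OF assms] and nN = normalised_byD(2)[OF assms]
  note G = subgrpD[OF subgrp_GS]
  have "subgrp (pull N)"
    using subgrpD[OF sN] G by (auto simp: subgrp_def pull_def put_mult put_inverse)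
  moreover have "g * z * inverse g \<in> pull N" if g: "g \<in> GS" and z: "z \<in> pull N" for g z
  proof -
    obtain h where h: "h \<in> GS" "\<And>y. root h y = y" "sec h 0 = g" using GS_lift[OF g] by metis
    have "put 0 (g * z * inverse g) = h * put 0 z * inverse h" by (simp add: conj_put h)
    also have "\<dots> \<in> N" using nN[OF h(1)] z by (auto simp: pull_def)
    finally show ?thesis using g z G by (auto simp: pull_def)
  qed
  ultimately show ?thesis by (simp add: normalised_by_def)
qed

lemma put_all:
  assumes "normalised_by N GS" "put 0 z \<in> N" shows "put x z \<in> N"
proof -
  have s: "put (x + 1) z \<in> N" if "put x z \<in> N" for x
    using normalised_byD(2)[OF assms(1) gs_a_GS that] by (simp add: conj_put)
  have "put 1 z \<in> N" using s[OF assms(2)] by simp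
  moreover from s[OF this] have "put 2 z \<in> N" by simp
  ultimately show ?thesis using assms(2) by (cases x rule: letter_cases) auto
qed

lemma layer_1_least:
  assumes M: "subgrp M" and "\<And>x z. z \<in> K \<Longrightarrow> put x z \<in> M" shows "layer 1 K \<subseteq> (M :: 3 aut set)"
proof
  fix g assume g: "g \<in> layer 1 K"
  have "g = put 0 (sec g 0) * (put 1 (sec g 1) * put 2 (sec g 2))"
  proof (rule aut_eqI)
    show "sec g x = sec (put 0 (sec g 0) * (put 1 (sec g 1) * put 2 (sec g 2))) x" for x
      by (cases x rule: letter_cases) (simp_all add: sec_put)
  qed (use g in simp)
  also have "\<dots> \<in> M" using g assms by (auto intro!: subgrpD(2)[OF M])
  finally show "g \<in> M" .
qed

lemma layer_least:
  assumes "subgrp M" and "\<And>u z. length u = n \<Longrightarrow> z \<in> K \<Longrightarrow> put_word u z \<in> M"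
  shows "layer n K \<subseteq> (M :: 3 aut set)"
  using assms
proof (induction n arbitrary: M)
  case 0
  then show ?case using "0.prems"(2)[of "[]"] by auto
next
  case (Suc n)
  have "layer n K \<subseteq> {z. put x z \<in> M}" for x
  proof (rule Suc.IH)
    show "subgrp {z. put x z \<in> M}"
      using subgrpD[OF Suc.prems(1)] by (auto simp: subgrp_def put_mult put_inverse)
    show "put_word u z \<in> {z. put x z \<in> M}" if "length u = n" "z \<in> K" for u z
      using Suc.prems(2)[of "x # u" z] that by simp
  qed
  then have "layer 1 (layer n K) \<subseteq> M" by (intro layer_1_least Suc.prems(1)) auto
  then show ?case by simp
qed

text \<open>
  The products \<open>tau 0 * tau 1\<close> and \<open>tau 0 * tau 2\<close> are each
  trivial at one letter, and these letters are different. Their commutator is therefore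
  concentrated at the letter \<open>0\<close>, and the value there is conjugate to the
  commutator of \<open>t\<close> with the inverse of \<open>a\<close>. So the part of the
  commutator subgroup at the letter \<open>0\<close> contains the normal closure of this
  commutator, which is the whole commutator subgroup.
\<close>

lemma layer_1_commsub_GS: "layer 1 (commsub GS) \<subseteq> commsub GS"
proof -
  let ?N = "pull (commsub GS)"
  note nN = normalised_by_pull[OF normalised_by_commsub_GS]
  note G = subgrpD[OF subgrp_GS] gs_a_GS gs_t_GS
  let ?w = "comm (gs_t * inverse gs_a) (gs_t * gs_a)"
  have "put 0 ?w = comm (tau 0 * tau 1) (tau 0 * tau 2)"
  proof (rule aut_eqI)
    show "sec (put 0 ?w) x = sec (comm (tau 0 * tau 1) (tau 0 * tau 2)) x" for x
      by (cases x rule: letter_cases)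
         (simp_all add: sec_comm sec_put sec_tau letter_numerals)
  qed (simp add: sec_comm)
  also have "\<dots> \<in> commsub GS" by (intro commsub.comm G tau_GS)
  finally have w: "?w \<in> ?N" by (auto simp: pull_def intro!: G subgrp_comm[OF subgrp_GS])
  have aa: "gs_a * (gs_a * x) = inverse gs_a * x" for x by (simp add: inverse_gs_a mult.assoc)
  have ai: "inverse gs_a * (inverse gs_a * x) = gs_a * x" for x
    by (metis aa inverse_mult_cancel)
  have "comm gs_t (inverse gs_a) = (gs_a * inverse gs_t) * ?w * inverse (gs_a * inverse gs_t)"
    using ai[of 1] by (simp add: comm_def mult.assoc aa ai)
  also have "\<dots> \<in> ?N" using G by (intro normalised_byD(2)[OF nN] w) auto
  finally have "inverse (gs_a * inverse (comm gs_t (inverse gs_a)) * inverse gs_a) \<in> ?N"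
    using G nN by (blast intro: normalised_byD subgrpD(3))
  also have "inverse (gs_a * inverse (comm gs_t (inverse gs_a)) * inverse gs_a) = comm gs_a gs_t"
    by (simp add: comm_def mult.assoc)
  finally have "commsub GS \<subseteq> ?N" by (rule commsub_GS_least[OF nN])
  then have "put x z \<in> commsub GS" if "z \<in> commsub GS" for x z
    using that put_all[OF normalised_by_commsub_GS, of z x] by (auto simp: pull_def)
  then show ?thesis by (intro layer_1_least subgrp_commsub)
qed

section \<open>Finite quotients and normal subgroups\<close>

text \<open>
  An element is determined modulo \<open>layer 1 K\<close> by its permutation of the letters
  and by the cosets of its sections modulo \<open>K\<close>.
\<close>

lemma finitely_covered_layer_1:
  fixes G :: "'x::finite aut set"
  assumes G: "\<And>g x. g \<in> G \<Longrightarrow> sec g x \<in> D" and D: "finitely_covered D K"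
  shows "finitely_covered G (layer 1 K)"
proof -
  obtain F where F: "finite F" "\<And>d. d \<in> D \<Longrightarrow> \<exists>f\<in>F. d * inverse f \<in> K"
    using D unfolding finitely_covered_def by blast
  let ?S = "Pi\<^sub>E UNIV (\<lambda>_ :: 'x. F)" and ?m = "\<lambda>(p, s). mk p s :: 'x aut"
  have "\<exists>f \<in> ?m ` (UNIV \<times> ?S). g * inverse f \<in> layer 1 K" if "g \<in> G" for g
  proof -
    have "\<forall>x. \<exists>f\<in>F. sec g x * inverse f \<in> K" using F(2) G[OF that] by blast
    then obtain s where s: "\<And>x. s x \<in> F" "\<And>x. sec g x * inverse (s x) \<in> K" by metis
    let ?f = "mk (root g) s"
    have r: "root g (root (inverse ?f) y) = y" for y
      using root_inverse_cancel(2)[of ?f y] by (simp add: bij_root)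
    have "g * inverse ?f \<in> layer 1 K"
      using s(2) by (simp add: r) (simp add: sec_inverse bij_root)
    then show ?thesis using s(1) by (intro bexI[of _ ?f]) (auto intro!: image_eqI[of _ _ "(root g, s)"])
  qed
  moreover have "finite (?m ` (UNIV \<times> ?S))"
    using F(1) by (intro finite_imageI finite_cartesian_product finite_PiE) auto
  ultimately show ?thesis unfolding finitely_covered_def by blast
qed

abbreviation "GS' \<equiv> commsub GS"
abbreviation "GS'' \<equiv> commsub (commsub GS)"

lemma GS'_subset: "GS' \<subseteq> GS"
  by (rule commsub_subset[OF subgrp_GS])

lemma GS''_subset: "GS'' \<subseteq> GS'"
  by (rule commsub_subset[OF subgrp_commsub])

lemma GS'_spelled: "z \<in> GS' \<Longrightarrow> \<exists>n. spelled z 0 0 n"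
proof (induction rule: commsub.induct)
  case one
  then show ?case using spelled.one by blast
next
  case (comm g h)
  then obtain i j n i' j' n' where "spelled g i j n" "spelled h i' j' n'" by (meson GSE)
  then have "spelled (comm g h) (i + i' + - i + - i') (j + j' + - j + - j') (n + n' + n + n')"
    unfolding comm_def by (intro spelled_mult spelled_inverse)
  then show ?case by auto
next
  case (mult x y)
  then show ?case using spelled_mult by fastforce
qed

lemma root_GS': "z \<in> GS' \<Longrightarrow> root z x = x"
  using GS'_spelled root_spelled by fastforce

text \<open>
  Already the commutators \<open>tau (c + 1) * inverse (tau c)\<close> of \<open>a\<close>
  and \<open>tau c\<close> have generators of the group as sections at the letter
  \<open>0\<close>.
\<close>

lemma secs_GS': "secs GS' 0 = GS"
proof
  show "secs GS' 0 \<subseteq> GS" using GS'_subset by (auto simp: secs_def sec_GS)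
  note S = subgrpD[OF subgrp_secs[OF subgrp_commsub[of GS], of 0]]
  have s: "sec (comm gs_a (tau c)) 0 \<in> secs GS' 0" for c
    by (intro secsI commsub.comm gs_a_GS tau_GS) (simp add: comm_def root_inverse_id)
  have c: "comm gs_a (tau c) = tau (c + 1) * inverse (tau c)" for c
    by (simp add: comm_def tau_Suc)
  have a: "inverse gs_a \<in> secs GS' 0"
    using s[of 1] by (simp add: c sec_inverse root_inverse_id sec_tau inverse_gs_a letter_numerals)
       (simp add: inverse_gs_a gs_a_cube mult.assoc)
  moreover have "gs_t * inverse gs_a \<in> secs GS' 0"
    using s[of 2] by (simp add: c sec_inverse root_inverse_id sec_tau letter_numerals)
  ultimately have "gs_a \<in> secs GS' 0" "gs_t \<in> secs GS' 0"
    using S(3)[OF a] S(2)[of "gs_t * inverse gs_a" gs_a] by (simp_all add: mult.assoc)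
  then show "GS \<subseteq> secs GS' 0" by (intro GS_least subgrp_secs subgrp_commsub)
qed

text \<open>
  Let \<open>h\<close> be an element of the commutator subgroup with section
  \<open>g\<close> at the letter \<open>0\<close>. The copy of \<open>x\<close> at this
  letter lies in the commutator subgroup too, and the commutator of these two elements is
  the copy of \<open>comm x g\<close>.
\<close>

lemma comm_mem_pull:
  assumes x: "x \<in> GS'" and g: "g \<in> GS"
  shows "comm x g \<in> pull GS''"
proof -
  have "g \<in> secs GS' 0" using g by (simp add: secs_GS')
  then obtain h where h: "h \<in> GS'" "\<And>y. root h y = y" "sec h 0 = g" by (auto simp: secs_def)
  have "put 0 (comm x g) = comm (put 0 x) h"
  proof (rule aut_eqI)
    show "sec (put 0 (comm x g)) y = sec (comm (put 0 x) h) y" for y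
      by (cases "y = 0") (auto simp: sec_comm sec_put h)
  qed (simp add: sec_comm h)
  moreover have "put 0 x \<in> layer 1 GS'"
    using x by (auto simp: sec_put commsub.one)
  then have "put 0 x \<in> GS'" using layer_1_commsub_GS by blast
  ultimately have "put 0 (comm x g) \<in> GS''"
    using h by (auto intro: commsub.comm)
  then show ?thesis using x g GS'_subset subgrp_comm[OF subgrp_GS] by (auto simp: pull_def)
qed

lemma power_mod_3: "x ^ k = x ^ (k mod 3)" if "x * (x * x) = 1" for x :: "'a::monoid_mult"
proof -
  have "x ^ k = (x ^ 3) ^ (k div 3) * x ^ (k mod 3)"
    by (simp add: power_add [symmetric] power_mult [symmetric])
  then show ?thesis using that by (simp add: power3_eq_cube mult.assoc)
qed

text \<open>
  Modulo \<open>C = pull (commsub (commsub GS))\<close> the commutator subgroup is central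
  by \<open>comm_mem_pull\<close>, so the group is nilpotent of class at most two there;
  being generated by two elements of order three it has at most 27 elements, represented by
  the products of powers of \<open>a\<close>, \<open>t\<close> and the commutator
  \<open>c\<close> of their inverses.
\<close>

lemma finitely_covered_pull: "finitely_covered GS (pull GS'')"
proof -
  let ?C = "pull GS''" and ?c = "comm (inverse gs_t) (inverse gs_a)"
  have nC: "normalised_by ?C GS"
    by (rule normalised_by_pull[OF normalised_by_commsub_commsub_GS])
  note sC = normalised_byD(1)[OF nC]
  note G = subgrpD[OF subgrp_GS] gs_a_GS gs_t_GS
  note refl = congr_refl[OF sC] and trans[trans] = congr_trans[OF sC]
    and mult = congr_mult[OF nC]
  have c: "?c ^ k \<in> GS'" for k
    by (intro subgrp_power subgrp_commsub commsub.comm G)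
  then have cG: "?c ^ k \<in> GS" for k using GS'_subset by blast
  have gG: "gs_a ^ k \<in> GS" "gs_t ^ k \<in> GS" for k by (intro subgrp_power subgrp_GS G)+
  have central: "congr ?C (?c ^ k * g) (g * ?c ^ k)" if "g \<in> GS" for k g
    using comm_mem_pull[OF c that] by (simp add: congr_def comm_def mult.assoc)
  \<comment> \<open>moving \<open>t\<close> past each \<open>a\<close> creates one central factor \<open>c\<close>\<close>
  have swap: "congr ?C (gs_t * gs_a ^ i) (gs_a ^ i * gs_t * ?c ^ i)" for i
  proof (induction i)
    case (Suc i)
    have "gs_t * gs_a ^ Suc i = gs_a * gs_t * (?c ^ 1 * gs_a ^ i)" by (simp add: comm_def mult.assoc)
    also have "congr ?C \<dots> (gs_a * gs_t * (gs_a ^ i * ?c ^ 1))"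
      by (intro mult refl central gG G)
    also have "gs_a * gs_t * (gs_a ^ i * ?c ^ 1) = gs_a * (gs_t * gs_a ^ i) * ?c" by (simp add: mult.assoc)
    also have "congr ?C \<dots> (gs_a * (gs_a ^ i * gs_t * ?c ^ i) * ?c)"
      by (intro mult refl Suc gG cG G)
    also have "\<dots> = (gs_a * gs_a ^ i) * gs_t * (?c ^ i * ?c)" by (simp only: mult.assoc)
    also have "\<dots> = gs_a ^ Suc i * gs_t * ?c ^ Suc i" by (simp only: power_Suc power_commutes)
    finally show ?case .
  qed (simp add: refl)
  have t: "\<exists>i j k. congr ?C (gs_t * g) (gs_a ^ i * gs_t ^ j * ?c ^ k)"
    if "\<exists>i j k. congr ?C g (gs_a ^ i * gs_t ^ j * ?c ^ k)" for g
  proof -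
    from that obtain i j k where "congr ?C g (gs_a ^ i * gs_t ^ j * ?c ^ k)" by blast
    then have "congr ?C (gs_t * g) (gs_t * (gs_a ^ i * gs_t ^ j * ?c ^ k))"
      by (intro mult refl G)
    also have "gs_t * (gs_a ^ i * gs_t ^ j * ?c ^ k) = gs_t * gs_a ^ i * (gs_t ^ j * ?c ^ k)" by (simp add: mult.assoc)
    also have "congr ?C \<dots> (gs_a ^ i * gs_t * ?c ^ i * (gs_t ^ j * ?c ^ k))"
      by (intro mult refl swap gG cG G)
    also have "\<dots> = gs_a ^ i * gs_t * (?c ^ i * gs_t ^ j) * ?c ^ k" by (simp add: mult.assoc)
    also have "congr ?C \<dots> (gs_a ^ i * gs_t * (gs_t ^ j * ?c ^ i) * ?c ^ k)"
      by (intro mult refl central gG cG G)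
    also have "\<dots> = gs_a ^ i * gs_t ^ Suc j * ?c ^ (i + k)" by (simp add: power_add mult.assoc)
    finally show ?thesis by blast
  qed
  have all: "\<exists>i j k. congr ?C g (gs_a ^ i * gs_t ^ j * ?c ^ k)" if "g \<in> GS" for g
  proof -
    from that obtain i j n where "spelled g i j n" by (rule GSE)
    then show ?thesis
    proof induction
      case one
      show ?case using refl[of 1] by (intro exI[of _ 0]) simp
    next
      case (a g i j n)
      then obtain i j k where "congr ?C g (gs_a ^ i * gs_t ^ j * ?c ^ k)" by blast
      then have "congr ?C (gs_a * g) (gs_a * (gs_a ^ i * gs_t ^ j * ?c ^ k))"
        by (intro mult refl G)
      then have "congr ?C (gs_a * g) (gs_a ^ Suc i * gs_t ^ j * ?c ^ k)" by (simp add: mult.assoc)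
      then show ?case by blast
    next
      case t
      then show ?case using \<open>\<And>g. \<exists>i j k. congr ?C g _ \<Longrightarrow> _\<close> by blast
    next
      case t'
      then show ?case using \<open>\<And>g. \<exists>i j k. congr ?C g _ \<Longrightarrow> _\<close> by (simp add: inverse_gs_t mult.assoc)
    qed
  qed
  have "congr ?C (gs_t * gs_a ^ 3) (gs_a ^ 3 * gs_t * ?c ^ 3)" by (rule swap)
  then have "gs_t * inverse (?c ^ 3) * inverse gs_t \<in> ?C"
    by (simp add: congr_def power3_eq_cube gs_a_cube mult.assoc)
  then have "inverse gs_t * (gs_t * inverse (?c ^ 3) * inverse gs_t) * inverse (inverse gs_t) \<in> ?C"
    by (rule normalised_byD(2)[OF nC G(3)[OF gs_t_GS]])
  then have c3: "inverse (?c ^ 3) \<in> ?C" by (simp add: mult.assoc)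
  have c3: "?c ^ 3 \<in> ?C" using subgrpD(3)[OF sC c3] by simp
  have cmod: "congr ?C (?c ^ k) (?c ^ (k mod 3))" for k
  proof -
    have "?c ^ k = (?c ^ 3) ^ (k div 3) * ?c ^ (k mod 3)"
      by (simp add: power_add [symmetric] power_mult [symmetric])
    then have "?c ^ k * inverse (?c ^ (k mod 3)) = (?c ^ 3) ^ (k div 3)"
      by (simp add: mult.assoc)
    also have "\<dots> \<in> ?C" by (rule subgrp_power[OF sC c3])
    finally show ?thesis by (simp add: congr_def)
  qed
  let ?F = "(\<lambda>(i, j, k). gs_a ^ i * gs_t ^ j * ?c ^ k) ` ({..<3} \<times> {..<3} \<times> {..<3})"
  have "\<exists>f\<in>?F. congr ?C g f" if g: "g \<in> GS" for g
  proof -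
    obtain i j k where "congr ?C g (gs_a ^ i * gs_t ^ j * ?c ^ k)" using all[OF g] by blast
    also have "congr ?C \<dots> (gs_a ^ i * gs_t ^ j * ?c ^ (k mod 3))"
      by (intro mult refl cmod gG G)
    also have "\<dots> = gs_a ^ (i mod 3) * gs_t ^ (j mod 3) * ?c ^ (k mod 3)"
      using power_mod_3[OF gs_a_cube, of i] power_mod_3[OF gs_t_cube, of j] by simp
    finally show ?thesis
      by (intro bexI, assumption) (auto intro!: image_eqI[of _ _ "(i mod 3, j mod 3, k mod 3)"])
  qed
  then show ?thesis unfolding finitely_covered_def congr_def[symmetric] by (intro exI[of _ ?F]) auto
qed

text \<open>
  Three copies of the subgroup of finite index from \<open>finitely_covered_pull\<close> lie
  in the second derived subgroup.
\<close>

lemma finitely_covered_GS'': "finitely_covered GS GS''"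
proof (rule finitely_covered_mono)
  show "finitely_covered GS (layer 1 (pull GS''))"
    by (rule finitely_covered_layer_1[OF sec_GS finitely_covered_pull])
  show "layer 1 (pull GS'') \<subseteq> GS''"
    using put_all[OF normalised_by_commsub_commsub_GS]
    by (intro layer_1_least subgrp_commsub) (auto simp: pull_def)
qed

lemma finitely_covered_layer: "finitely_covered GS (layer n GS'')"
proof (induction n)
  case (Suc n)
  then show ?case using finitely_covered_layer_1[OF sec_GS Suc] by simp
qed (simp add: finitely_covered_GS'')

lemma layer_GS': "layer n GS' \<subseteq> GS'"
proof (induction n)
  case (Suc n)
  have "layer 1 (layer n GS') \<subseteq> layer 1 GS'" by (rule layer_mono[OF Suc])
  then show ?case using layer_1_commsub_GS by simp
qed simp

lemma put_word_layer: "z \<in> K \<Longrightarrow> 1 \<in> K \<Longrightarrow> put_word u z \<in> layer (length u) K"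
proof (induction u)
  case (Cons x u)
  have "1 \<in> layer n K" for n using Cons.prems by (induction n) auto
  then show ?case using Cons by (auto simp: sec_put)
qed simp

lemma sec_word_GS: "g \<in> GS \<Longrightarrow> sec_word g u \<in> GS"
  by (induction u arbitrary: g) (auto simp: sec_GS)

text \<open>
  The commutator trick for branch groups. If \<open>q\<close> moves \<open>u\<close>, then
  the conjugates by \<open>q\<close> of elements supported below \<open>u\<close> are
  supported elsewhere, so a double commutator of \<open>q\<close> with two such elements is,
  up to an inverse, the commutator of the two; it belongs to \<open>Q\<close>. Transitivity
  carries this to the other vertices of the level.
\<close>

lemma layer_subset_normal:
  assumes Q: "normalised_by Q GS" and q: "q \<in> Q" "act q u \<noteq> u"
  shows "layer (length u) GS'' \<subseteq> Q"
proof -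
  note sQ = normalised_byD(1)[OF Q] and nQ = normalised_byD(2)[OF Q]
  note G = subgrpD[OF subgrp_GS]
  have pG: "put_word u z \<in> GS" if "z \<in> GS'" for z
    using put_word_layer[OF that commsub.one] layer_GS' GS'_subset by blast
  have *: "put_word u (comm x y) \<in> Q" if "x \<in> GS'" "y \<in> GS'" for x y
  proof -
    \<comment> \<open>the inverse of \<open>x\<close> makes the double commutator below equal to the copy of \<open>comm x y\<close>\<close>
    let ?X = "put_word u (inverse x)" and ?Y = "put_word u y"
    let ?c = "q * (?X * inverse q * inverse ?X)" and ?X' = "q * ?X * inverse q"
    have X: "?X \<in> GS" "?Y \<in> GS" using pG that subgrpD(3)[OF subgrp_commsub] by blast+
    have c: "?c \<in> Q" by (intro subgrpD(2)[OF sQ q(1)] nQ[OF X(1)] subgrpD(3)[OF sQ q(1)])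
    have "?c * (?Y * inverse ?c * inverse ?Y) \<in> Q"
      by (intro subgrpD(2)[OF sQ c] nQ[OF X(2)] subgrpD(3)[OF sQ c])
    also have "?c * (?Y * inverse ?c * inverse ?Y) = comm (?X' * inverse ?X) ?Y"
      by (simp add: comm_def mult.assoc)
    also have "\<dots> = comm (inverse ?X) ?Y"
    proof -
      have X': "?X' = put_word (act q u) (sec_word q u * inverse x * inverse (sec_word q u))"
        by (rule conj_put_word)
      have c: "?X' * put_word u z = put_word u z * ?X'" for z
        unfolding X' by (rule put_word_commute) (use q in auto)
      have "comm (inverse ?X) ?Y = put_word u (comm x y)" by (simp add: put_word_comm put_word_inverse)
      then have "?X' * comm (inverse ?X) ?Y * inverse ?X' = comm (inverse ?X) ?Y"
        unfolding c by (metis (no_types) c mult.assoc right_inverse_mult mult_1_right)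
      moreover have "comm ?X' ?Y = 1" unfolding comm_def c by (simp add: mult.assoc)
      ultimately show ?thesis unfolding comm_mult_left[of ?X'] by simp
    qed
    finally show ?thesis by (simp add: put_word_comm put_word_inverse)
  qed
  have u: "put_word u z \<in> Q" if "z \<in> GS''" for z
    using that by induction (use * sQ in \<open>auto simp: put_word_mult subgrpD\<close>)
  have "put_word v z \<in> Q" if v: "length v = length u" and z: "z \<in> GS''" for v z
  proof -
    obtain g where g: "g \<in> GS" "act g u = v" using GS_transitive[of u v] v by auto
    let ?s = "sec_word g u"
    have "inverse ?s * z * inverse (inverse ?s) \<in> GS''"
      by (intro normalised_byD(2)[OF normalised_by_commsub_commsub_GS] G sec_word_GS g z)
    then have "g * put_word u (inverse ?s * z * inverse (inverse ?s)) * inverse g \<in> Q"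
      by (intro nQ u g)
    then show ?thesis unfolding conj_put_word by (simp add: g mult.assoc)
  qed
  then show ?thesis by (intro layer_least sQ) auto
qed

text \<open>
  Commutators fix the first level, and the derived series of a direct product is computed
  componentwise.
\<close>

lemma commsub_power_Suc_layer: "(commsub ^^ Suc k) GS \<subseteq> layer 1 ((commsub ^^ k) GS)"
proof (induction k)
  case 0
  then show ?case using GS'_subset by (auto simp: root_GS' intro: sec_GS)
next
  case (Suc k)
  show ?case
    using commsub_mono[OF Suc] commsub_layer1[of "(commsub ^^ k) GS"] by simp
qed

lemma commsub_power_layer: "(commsub ^^ (n + m)) GS \<subseteq> layer n ((commsub ^^ m) GS)"
proof (induction n)
  case (Suc n)
  show ?case
    using commsub_power_Suc_layer[of "n + m"] layer_mono[OF Suc, of 1] by simp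
qed simp

text \<open>
  By \<open>absorb_commsub_power\<close> the second derived subgroup in the hypothesis may
  be replaced by any later one, hence by \<open>layer n\<close> for every \<open>n\<close>.
  If \<open>Q\<close> is not trivial, it contains some layer; if it is trivial, then the
  commutator subgroup fixes every word.
\<close>

lemma GS'_subset_normal:
  assumes Q: "normalised_by Q GS" and le: "GS' \<subseteq> setmult Q GS''"
  shows "GS' \<subseteq> Q"
proof -
  note sQ = normalised_byD(1)[OF Q]
  have le': "GS' \<subseteq> setmult Q (layer n GS'')" for n
  proof -
    have "GS' \<subseteq> setmult Q ((commsub ^^ Suc (Suc n)) GS)"
      by (rule absorb_commsub_power[OF subgrp_GS Q le])
    also have "\<dots> \<subseteq> setmult Q (layer n GS'')"
      using commsub_power_layer[of n 2] unfolding setmult_def by (auto simp: numeral_2_eq_2)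
    finally show ?thesis .
  qed
  show ?thesis
  proof (cases "\<exists>q\<in>Q. \<exists>u. act q u \<noteq> u")
    case True
    then obtain q u where "q \<in> Q" "act q u \<noteq> u" by blast
    then have "layer (length u) GS'' \<subseteq> Q" by (rule layer_subset_normal[OF Q])
    then show ?thesis using le'[of "length u"] subgrpD(2)[OF sQ] unfolding setmult_def by blast
  next
    case False
    have "z = 1" if z: "z \<in> GS'" for z
    proof (rule aut_eq_actI)
      fix u :: "3 list"
      obtain q d where "z = q * d" "q \<in> Q" "d \<in> layer (length u) GS''"
        using z le'[of "length u"] unfolding setmult_def by blast
      then show "act z u = act 1 u" using False layer_fixes[of d "length u" GS'' u] by simp
    qed
    then show ?thesis using subgrpD(1)[OF sQ] by blast
  qed
qed

section \<open>Dense subgroups of the Gupta-Sidki group\<close>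

text \<open>
  On the stabiliser of the first level the sections at \<open>x\<close> and \<open>y\<close>
  are homomorphisms, so a commutator of lifts is a lift of the commutator, and its section
  at the other letter is again a commutator.
\<close>

lemma commsub_lift:
  assumes M: "subgrp M"
    and lift: "\<And>b. b \<in> B \<Longrightarrow> \<exists>m\<in>M. (\<forall>z. root m z = z) \<and> sec m y = b \<and> sec m x \<in> C"
    and b: "b \<in> commsub B"
  shows "\<exists>m\<in>M. (\<forall>z. root m z = z) \<and> sec m y = b \<and> sec m x \<in> commsub C"
  using b
proof induction
  case one
  then show ?case using subgrpD(1)[OF M] by (intro bexI[of _ 1]) (auto intro: commsub.one)
next
  case (comm b c)
  obtain m n where "m \<in> M" "\<forall>z. root m z = z" "sec m y = b" "sec m x \<in> C"
    "n \<in> M" "\<forall>z. root n z = z" "sec n y = c" "sec n x \<in> C"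
    using lift[OF comm(1)] lift[OF comm(2)] by blast
  then show ?case
    using subgrp_comm[OF M] by (intro bexI[of _ "comm m n"]) (auto simp: sec_comm intro: commsub.comm)
next
  case (mult b c)
  obtain m n where "m \<in> M" "\<forall>z. root m z = z" "sec m y = b" "sec m x \<in> commsub C"
    "n \<in> M" "\<forall>z. root n z = z" "sec n y = c" "sec n x \<in> commsub C"
    using mult.IH by blast
  then show ?case
    using subgrpD(2)[OF M] by (intro bexI[of _ "m * n"]) (auto intro: commsub.mult)
qed

text \<open>
  The sections at \<open>x\<close> of the elements of \<open>M\<close> that are trivial at
  \<open>y\<close> form a normal subgroup \<open>Q\<close>. By hypothesis \<open>M\<close>
  contains the copy of a given \<open>w\<close> at \<open>x\<close> up to an error in the
  second derived subgroup; the error at \<open>y\<close> is cancelled with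
  \<open>commsub_lift\<close> at the cost of another such error at \<open>x\<close>. So
  \<open>GS'_subset_normal\<close> applies to \<open>Q\<close>.
\<close>

lemma GS'_two_letters:
  assumes M: "subgrp M" and secs: "\<And>x. secs M x = GS"
    and le: "layer 1 GS' \<subseteq> setmult M (layer 1 GS'')" and xy: "x \<noteq> y" and z: "z \<in> GS'"
  obtains m where "m \<in> M" "\<And>v. root m v = v" "sec m x = z" "sec m y = 1"
proof -
  note m = subgrpD[OF M]
  define L where "L = {m \<in> M. (\<forall>v. root m v = v) \<and> sec m y = 1}"
  let ?Q = "secs L x"
  have "subgrp L"
    using m by (auto simp: L_def subgrp_def sec_inverse root_inverse_id)
  then have sQ: "subgrp ?Q" by (rule subgrp_secs)
  have "g * q * inverse g \<in> ?Q" if g: "g \<in> GS" and q: "q \<in> ?Q" for g q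
  proof -
    have "g \<in> secs M x" using g secs by simp
    then obtain h where h: "h \<in> M" "\<And>v. root h v = v" "sec h x = g" by (auto simp: secs_def)
    from q obtain l where l: "l \<in> L" "sec l x = q" by (auto simp: secs_def)
    have "h * l * inverse h \<in> L"
      using h l m by (auto simp: L_def sec_inverse root_inverse_id)
    then have "sec (h * l * inverse h) x \<in> ?Q" by (rule secsI) (use h l in \<open>auto simp: L_def root_inverse_id\<close>)
    then show ?thesis using h l by (simp add: L_def sec_inverse root_inverse_id mult.assoc)
  qed
  then have nQ: "normalised_by ?Q GS" using sQ by (simp add: normalised_by_def)
  have lift0: "\<exists>m\<in>M. (\<forall>v. root m v = v) \<and> sec m y = b \<and> sec m x \<in> GS" if b: "b \<in> GS" for b
  proof -
    have "b \<in> secs M y" using b secs by simp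
    then obtain h where "h \<in> M" "\<And>v. root h v = v" "sec h y = b" by (auto simp: secs_def)
    moreover have "sec h x \<in> secs M x" by (rule secsI) fact+
    ultimately show ?thesis using secs by auto
  qed
  have lift: "\<exists>m\<in>M. (\<forall>v. root m v = v) \<and> sec m y = b \<and> sec m x \<in> GS''" if "b \<in> GS''" for b
    by (rule commsub_lift[OF M commsub_lift[OF M lift0] that])
  have "GS' \<subseteq> setmult ?Q GS''"
  proof
    fix w assume w: "w \<in> GS'"
    have "put x w \<in> layer 1 GS'" using w by (auto simp: sec_put commsub.one)
    then obtain m l where ml: "put x w = m * l" "m \<in> M" "l \<in> layer 1 GS''"
      using le unfolding setmult_def by blast
    have lr: "root l v = v" for v using ml(3) by simp
    have mr: "root m v = v" for v
      using arg_cong[OF ml(1), of "\<lambda>g. root g v"] lr by simp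
    have sx: "sec m x * sec l x = w" and sy: "sec m y * sec l y = 1"
      using arg_cong[OF ml(1), of "\<lambda>g. sec g x"] arg_cong[OF ml(1), of "\<lambda>g. sec g y"] lr xy
      by (simp_all add: sec_put)
    have l: "sec l v \<in> GS''" for v using ml(3) by simp
    have "sec m y = inverse (sec l y)" using inverse_eqI[OF sy] by (metis inverse_of_inverse)
    then have "sec m y \<in> GS''" using subgrpD(3)[OF subgrp_commsub l] by simp
    \<comment> \<open>cancels the section of \<open>m\<close> at \<open>y\<close>\<close>
    from lift[OF this] obtain m' where m': "m' \<in> M" "\<And>v. root m' v = v" "sec m' y = sec m y"
      "sec m' x \<in> GS''" by blast
    have "m * inverse m' \<in> L"
      using ml(2) m' mr m by (auto simp: L_def sec_inverse root_inverse_id)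
    then have "sec (m * inverse m') x \<in> ?Q" by (rule secsI) (simp add: mr m' root_inverse_id)
    moreover have "sec (m * inverse m') x = w * inverse (sec m' x * sec l x)"
      by (simp add: m' mr sec_inverse root_inverse_id mult.assoc flip: sx)
    ultimately have "w * inverse (sec m' x * sec l x) \<in> ?Q" by (simp only:)
    then show "w \<in> setmult ?Q GS''"
      unfolding mem_setmult[OF sQ] by (rule bexI[OF _ commsub.mult[OF m'(4) l]])
  qed
  then have "z \<in> ?Q" using GS'_subset_normal[OF nQ] z by blast
  then show ?thesis using that by (auto simp: secs_def L_def)
qed

text \<open>
  An element with sections \<open>(u,1,*)\<close> and one with sections
  \<open>(v,*,1)\<close> have a commutator that is concentrated at a single letter.
\<close>

lemma layer_subset_of_secs:
  assumes M: "subgrp M" and secs: "\<And>x. secs M x = GS"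
    and le: "layer 1 GS' \<subseteq> setmult M (layer 1 GS'')"
  shows "layer 1 GS'' \<subseteq> M"
proof (rule layer_1_least[OF M])
  fix x :: 3 and z assume z: "z \<in> GS''"
  note m = subgrpD[OF M]
  from z show "put x z \<in> M"
  proof induction
    case (comm u v)
    obtain m where m1: "m \<in> M" "\<And>v. root m v = v" "sec m x = u" "sec m (x + 1) = 1"
      by (rule GS'_two_letters[OF M secs le, of x "x + 1" u]) (use comm in auto)
    obtain n where n1: "n \<in> M" "\<And>v. root n v = v" "sec n x = v" "sec n (x + 2) = 1"
      by (rule GS'_two_letters[OF M secs le, of x "x + 2" v]) (use comm in auto)
    have "put x (comm u v) = comm m n"
    proof (rule aut_eqI)
      fix y :: 3
      consider "y = x" | "y = x + 1" | "y = x + 2"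
        by (cases "y - x" rule: letter_cases) (auto simp: algebra_simps)
      then show "sec (put x (comm u v)) y = sec (comm m n) y"
        by cases (simp_all add: sec_put sec_comm m1 n1)
    qed (simp add: sec_comm m1 n1)
    then show ?case using subgrp_comm[OF M m1(1) n1(1)] by simp
  qed (simp_all add: m put_mult)
qed

lemma subset_of_secs:
  assumes M: "subgrp M" and secs: "\<And>x. secs M x = GS"
    and G: "layer 1 GS' \<subseteq> G" and le: "G \<subseteq> setmult M (layer 1 GS'')"
  shows "G \<subseteq> M"
proof -
  have "layer 1 GS'' \<subseteq> M" by (rule layer_subset_of_secs[OF M secs]) (use G le in blast)
  then have "setmult M (layer 1 GS'') \<subseteq> M" using subgrpD(2)[OF M] unfolding setmult_def by blast
  with le show ?thesis by blast
qed

text \<open>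
  Density is inherited by the projection to a letter, with a shift of the level by one.
\<close>

lemma secs_setmult:
  assumes G: "\<And>g. g \<in> D \<Longrightarrow> \<exists>k\<in>G. (\<forall>y. root k y = y) \<and> sec k x = g"
    and le: "G \<subseteq> setmult M (layer (Suc n) K)"
  shows "D \<subseteq> setmult (secs M x) (layer n K)"
proof
  fix g assume "g \<in> D"
  then obtain k where k: "k \<in> G" "\<forall>y. root k y = y" "sec k x = g" using G by blast
  then obtain m l where ml: "k = m * l" "m \<in> M" "l \<in> layer (Suc n) K"
    using le unfolding setmult_def by blast
  have "root m y = y" for y using k(2) ml by simp
  then have "sec m x \<in> secs M x" using ml by (intro secsI) auto
  then show "g \<in> setmult (secs M x) (layer n K)" using k(3) ml unfolding setmult_def by auto
qed

text \<open>
  Density for the topology on the group in which the subgroups \<open>layer n\<close> of the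
  second derived subgroup form a basis of neighbourhoods of \<open>1\<close>.
\<close>

definition dense :: "3 aut set \<Rightarrow> bool" where
  "dense H \<longleftrightarrow> subgrp H \<and> H \<subseteq> GS \<and> (\<forall>n. GS \<subseteq> setmult H (layer n GS''))"

lemma denseE:
  assumes "dense H" "g \<in> GS"
  obtains h l where "g = h * l" "h \<in> H" "l \<in> layer n GS''"
proof -
  have "g \<in> setmult H (layer n GS'')" using assms by (auto simp: dense_def)
  then show ?thesis using that by (auto simp: setmult_def)
qed

lemma dense_secs: assumes "dense H" shows "dense (secs H x)"
  unfolding dense_def
proof (intro conjI allI)
  show "subgrp (secs H x)" using assms by (simp add: dense_def subgrp_secs)
  show "secs H x \<subseteq> GS" using assms by (auto simp: dense_def secs_def sec_GS)
  fix n
  have "GS \<subseteq> setmult H (layer (Suc n) GS'')" using assms unfolding dense_def by blast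
  then show "GS \<subseteq> setmult (secs H x) (layer n GS'')"
    by (rule secs_setmult[rotated]) (meson GS_lift)
qed

text \<open>
  At level \<open>0\<close> density provides representatives modulo the second derived
  subgroup, whose elements have exponent sums zero.
\<close>

lemma dense_spelled:
  assumes H: "dense H" and g: "spelled g i j n" obtains h n' where "h \<in> H" "spelled h i j n'"
proof -
  obtain h w where hw: "g = h * w" "h \<in> H" "w \<in> GS''"
    using denseE[OF H GSI[OF g], of 0] by auto
  have "inverse w \<in> GS'" using hw GS''_subset subgrpD(3)[OF subgrp_commsub] by blast
  then obtain n' where "spelled (inverse w) 0 0 n'" using GS'_spelled by blast
  then have "spelled (g * inverse w) (i + 0) (j + 0) (n + n')" by (rule spelled_mult[OF g])
  then show ?thesis using that hw by (simp add: mult.assoc)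
qed

text \<open>
  An element of \<open>H\<close> that rotates the letters conjugates the projections at the
  different letters into each other; so one full projection suffices for
  \<open>subset_of_secs\<close>.
\<close>

lemma dense_eq_GS_of_secs:
  assumes H: "dense H" and x: "secs H x = GS"
  shows "H = GS"
proof -
  have sH: "subgrp H" and HG: "H \<subseteq> GS" using H by (simp_all add: dense_def)
  obtain h n where h: "h \<in> H" "spelled h 1 0 n" using dense_spelled[OF H spelled_gs_a] by blast
  have hr: "root h y = y + 1" for y using root_spelled[OF h(2)] by simp
  have step: "secs H (y + 1) = GS" if y: "secs H y = GS" for y
  proof
    show "secs H (y + 1) \<subseteq> GS" using dense_secs[OF H] by (simp add: dense_def)
    show "GS \<subseteq> secs H (y + 1)"
    proof
      fix g assume g: "g \<in> GS"
      let ?s = "sec h y"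
      have s: "?s \<in> GS" using h HG sec_GS by blast
      have "inverse ?s * g * ?s \<in> GS" by (intro subgrpD[OF subgrp_GS] s g)
      then have "inverse ?s * g * ?s \<in> secs H y" using y by simp
      then obtain k where k: "k \<in> H" "\<And>v. root k v = v" "sec k y = inverse ?s * g * ?s"
        by (auto simp: secs_def)
      have r: "root (inverse h) (y + 1) = y" by (metis hr root_inverse_cancel(1))
      have "sec (h * k * inverse h) (y + 1) \<in> secs H (y + 1)"
        by (rule secsI) (use h k sH in \<open>auto intro!: subgrpD(2,3)\<close>)
      moreover have "sec (h * k * inverse h) (y + 1) = g"
        by (simp add: r k sec_inverse mult.assoc)
      ultimately show "g \<in> secs H (y + 1)" by simp
    qed
  qed
  have "secs H y = GS" for y
  proof -
    have 1: "secs H (x + 1) = GS" by (rule step[OF x])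
    have 2: "secs H (x + 1 + 1) = GS" by (rule step[OF 1])
    show ?thesis using x 1 2 by (cases "y - x" rule: letter_cases) (auto simp: algebra_simps)
  qed
  moreover have "layer 1 GS' \<subseteq> GS" using layer_1_commsub_GS GS'_subset by (rule order_trans)
  moreover have "GS \<subseteq> setmult H (layer 1 GS'')" using H unfolding dense_def by blast
  ultimately have "GS \<subseteq> H" by (rule subset_of_secs[OF sH])
  with HG show ?thesis by blast
qed

lemma normalised_by_layer: "normalised_by (layer n GS'') GS"
proof (induction n)
  case (Suc n)
  have "g * l * inverse g \<in> layer (Suc n) GS''" if g: "g \<in> GS" and l: "l \<in> layer (Suc n) GS''" for g l
    using normalised_byD(2)[OF Suc] g l by (auto simp: sec_inverse sec_GS)
  then show ?case using subgrp_layer[OF subgrp_commsub] by (auto simp: normalised_by_def simp del: layer.simps)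
qed (simp add: normalised_by_commsub_commsub_GS)

text \<open>
  The conjugate of \<open>H\<close> by the inverse of \<open>u\<close>, so that membership
  of \<open>x\<close> means that \<open>u * x * inverse u\<close> belongs to
  \<open>H\<close>.
\<close>

definition conjset :: "'a::multiplicative_group \<Rightarrow> 'a set \<Rightarrow> 'a set" where
  "conjset u H = {inverse u * h * u | h. h \<in> H}"

lemma mem_conjset: "x \<in> conjset u H \<longleftrightarrow> u * x * inverse u \<in> H"
proof
  assume "u * x * inverse u \<in> H"
  moreover have "x = inverse u * (u * x * inverse u) * u" by (simp add: mult.assoc)
  ultimately show "x \<in> conjset u H" unfolding conjset_def by blast
qed (auto simp: conjset_def mult.assoc)

lemma dense_conjset:
  assumes H: "dense H" and u: "u \<in> GS" shows "dense (conjset u H)"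
proof -
  note G = subgrpD[OF subgrp_GS]
  have sH: "subgrp H" and HG: "H \<subseteq> GS" using H by (simp_all add: dense_def)
  have "subgrp (conjset u H)"
    unfolding subgrp_def mem_conjset
  proof (intro conjI ballI)
    show "u * 1 * inverse u \<in> H" using subgrpD(1)[OF sH] by simp
    fix x y
    assume x: "x \<in> conjset u H" and y: "y \<in> conjset u H"
    show "u * (x * y) * inverse u \<in> H"
      unfolding conj_mult using x y subgrpD(2)[OF sH] unfolding mem_conjset by blast
    have "inverse (u * x * inverse u) \<in> H" using x by (intro subgrpD(3)[OF sH]) (simp add: mem_conjset)
    then show "u * inverse x * inverse u \<in> H" by (simp add: mult.assoc)
  qed
  moreover have "conjset u H \<subseteq> GS" using HG u G by (auto simp: conjset_def)
  moreover have "GS \<subseteq> setmult (conjset u H) (layer n GS'')" for n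
  proof
    fix g assume g: "g \<in> GS"
    have "u * g * inverse u \<in> GS" by (intro G u g)
    then obtain h l where hl: "u * g * inverse u = h * l" "h \<in> H" "l \<in> layer n GS''"
      by (rule denseE[OF H])
    have "g = inverse u * (u * g * inverse u) * u" by (simp add: mult.assoc)
    also have "\<dots> = (inverse u * h * u) * (inverse u * l * inverse (inverse u))" unfolding hl(1) by (simp add: mult.assoc)
    finally show "g \<in> setmult (conjset u H) (layer n GS'')"
      using normalised_byD(2)[OF normalised_by_layer G(3)[OF u] hl(3)] hl(2) unfolding setmult_def conjset_def by blast
  qed
  ultimately show ?thesis by (simp add: dense_def)
qed

lemma conjset_eq_GS:
  assumes "conjset u H = GS" "u \<in> GS" "H \<subseteq> GS" shows "H = GS"
proof -
  have "g \<in> H" if g: "g \<in> GS" for g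
  proof -
    have "inverse u * g * u \<in> conjset u H" unfolding assms(1) by (intro subgrpD[OF subgrp_GS] assms g)
    then show ?thesis by (simp add: mem_conjset mult.assoc)
  qed
  then show ?thesis using assms by blast
qed

text \<open>
  Let \<open>X y\<close> be the section of \<open>x\<close> that ends up at position
  \<open>y\<close>. The projection \<open>S\<close> of \<open>H\<close> does not depend on
  the letter, since \<open>a\<close> rotates the letters, and it contains the conjugate of
  \<open>t\<close> by \<open>X i\<close> and the conjugates of \<open>a\<close> by \<open>X
  (i + 1)\<close> and \<open>X (i + 2)\<close>. After conjugating \<open>S\<close> by one of
  the latter two, it contains \<open>a\<close> and the conjugate of \<open>t\<close> by an
  element whose length is at most the total length of two of the three sections. This is a
  shorter conjugating element, unless all occurrences of \<open>t\<close> in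
  \<open>x\<close> go to position \<open>i\<close>; in this case the given conjugate of
  \<open>t\<close> equals \<open>tau i\<close>.
\<close>

lemma dense_eq_GS_of_conj:
  assumes "dense H" "gs_a \<in> H" "spelled x i j n" "x * gs_t * inverse x \<in> H"
  shows "H = GS"
  using assms
proof (induction n arbitrary: H x i j rule: less_induct)
  case (less n H x i j)
  note H = less.prems(1)
  have sH: "subgrp H" using H by (simp add: dense_def)
  note m = subgrpD[OF sH] less.prems(2)
  obtain J N where JN: "\<And>y. spelled (sec x (y - i)) (J (y - 1) - J (y + 1)) (J y) (N y)"
    "N 0 + N 1 + N 2 = n" "\<And>y. N y = n \<Longrightarrow> \<exists>k. of_nat k = j \<and> sec x (y - i) = gs_t ^ k"
    using spelled_sections[OF less.prems(3)] by blast
  let ?X = "\<lambda>y. sec x (y - i)" and ?k = "x * gs_t * inverse x" and ?S = "secs H 0"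
  have rot: "s \<in> secs H (y + 1)" if "s \<in> secs H y" for s y
  proof -
    from that obtain h where h: "h \<in> H" "\<And>v. root h v = v" "sec h y = s" by (auto simp: secs_def)
    have "sec (gs_a * h * inverse gs_a) (y + 1) \<in> secs H (y + 1)"
      by (rule secsI) (simp_all add: m h)
    then show ?thesis using h by simp
  qed
  have S: "s \<in> ?S" if s: "s \<in> secs H y" for s y
    using s rot[OF s] rot[OF rot[OF s]] by (cases y rule: letter_cases) (auto simp: letter_numerals)
  have sS: "subgrp ?S" by (rule subgrp_secs[OF sH])
  have rk: "root ?k y = y" for y by simp
  have ri: "root (inverse x) y = y - i" for y
    using root_spelled[OF spelled_inverse[OF less.prems(3)]] by simp
  have sk: "sec ?k y = ?X y * sec gs_t (y - i) * inverse (?X y)" for y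
    by (simp add: sec_inverse ri)
  have kS: "?X y * sec gs_t (y - i) * inverse (?X y) \<in> ?S" for y
    using S[OF secsI[OF less.prems(4) rk], of y] unfolding sk .
  have t: "?X i * gs_t * inverse (?X i) \<in> ?S" using kS[of i] by (simp add: sec_gs_t)
  have a1: "?X (i + 1) * gs_a * inverse (?X (i + 1)) \<in> ?S"
    using kS[of "i + 1"] by (simp add: sec_gs_t)
  \<comment> \<open>the section of \<open>t\<close> at \<open>2\<close> is the inverse of \<open>a\<close>\<close>
  have a2: "?X (i + 2) * gs_a * inverse (?X (i + 2)) \<in> ?S"
    using subgrpD(3)[OF sS kS[of "i + 2"]] by (simp add: sec_gs_t mult.assoc)
  have N: "N i + N (i + 1) + N (i + 2) = n"
    using JN(2) by (cases i rule: letter_cases) (auto simp: letter_numerals)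
  show ?case
  proof (cases "N (i + 1) = 0 \<and> N (i + 2) = 0")
    case False
    obtain y where y: "?X y * gs_a * inverse (?X y) \<in> ?S" "N i + N y < n"
    proof (cases "N (i + 1) = 0")
      case True
      then show thesis using that[OF a1] False N by simp
    next
      case nz: False
      then show thesis using that[OF a2] N by simp
    qed
    let ?u = "?X y"
    have u: "?u \<in> GS" by (rule GSI[OF JN(1)])
    have "conjset ?u ?S = GS"
    proof (rule less.IH)
      show "N y + N i < n" using y by simp
      show "dense (conjset ?u ?S)" by (intro dense_conjset dense_secs H u)
      show "gs_a \<in> conjset ?u ?S" using y by (simp add: mem_conjset)
      show "spelled (inverse ?u * ?X i) (- (J (y - 1) - J (y + 1)) + (J (i - 1) - J (i + 1))) (- J y + J i) (N y + N i)"
        by (intro spelled_mult spelled_inverse JN(1))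
      show "inverse ?u * ?X i * gs_t * inverse (inverse ?u * ?X i) \<in> conjset ?u ?S"
        using t by (simp add: mem_conjset mult.assoc)
    qed
    then have "?S = GS" by (rule conjset_eq_GS[OF _ u]) (use dense_secs[OF H] in \<open>simp add: dense_def\<close>)
    then show ?thesis by (rule dense_eq_GS_of_secs[OF H])
  next
    case True
    obtain p where p: "?X i = gs_t ^ p" using JN(3)[of i] N True by auto
    obtain q where q: "?X (i + 1) = gs_a ^ q" using spelled_0[OF JN(1)[of "i + 1"]] True by auto
    obtain r where r: "?X (i + 2) = gs_a ^ r" using spelled_0[OF JN(1)[of "i + 2"]] True by auto
    have pc: "b ^ k * b * inverse (b ^ k) = b" for b :: "3 aut" and k
      by (simp add: power_commutes mult.assoc)
    have pc': "b ^ k * inverse b * inverse (b ^ k) = inverse b" for b :: "3 aut" and k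
      using arg_cong[OF pc[of b k], of inverse] by (simp add: mult.assoc)
    have "?k = tau i"
    proof (rule aut_eqI)
      fix y
      consider "y = i" | "y = i + 1" | "y = i + 2"
        by (cases "y - i" rule: letter_cases) (auto simp: algebra_simps)
      then show "sec ?k y = sec (tau i) y"
        unfolding sk
      proof cases
        case 1
        then show "?X y * sec gs_t (y - i) * inverse (?X y) = sec (tau i) y"
          using p pc[of gs_t] by (simp add: sec_gs_t sec_tau)
      next
        case 2
        then show "?X y * sec gs_t (y - i) * inverse (?X y) = sec (tau i) y"
          using q pc[of gs_a] by (simp add: sec_gs_t sec_tau)
      next
        case 3
        then show "?X y * sec gs_t (y - i) * inverse (?X y) = sec (tau i) y"
          using r pc'[of gs_a] by (simp add: sec_gs_t sec_tau)
      qed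
    qed simp
    then have ti: "tau i \<in> H" using less.prems(4) by simp
    have s: "tau (c + 1) \<in> H" if "tau c \<in> H" for c
      unfolding tau_Suc[symmetric] by (intro m that)
    have "tau 0 \<in> H"
      using ti s[OF ti] s[OF s[OF ti]] by (cases i rule: letter_cases) (auto simp: letter_numerals)
    then have "GS \<subseteq> H" by (intro GS_least sH m) (simp add: tau_0)
    then show ?thesis using H by (auto simp: dense_def)
  qed
qed

text \<open>
  The sections of \<open>t\<close> at the letters \<open>0\<close> and \<open>1\<close> are
  \<open>t\<close> and \<open>a\<close>. Conjugating \<open>t\<close> by an element of
  \<open>H\<close> that maps \<open>0\<close> to \<open>1\<close> puts a conjugate of
  \<open>t\<close> next to \<open>a\<close> in the projection at the letter
  \<open>1\<close>.
\<close>

lemma dense_eq_GS_of_gs_t: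
  assumes H: "dense H" and t: "gs_t \<in> H" shows "H = GS"
proof -
  have sH: "subgrp H" and HG: "H \<subseteq> GS" using H by (simp_all add: dense_def)
  note m = subgrpD[OF sH]
  obtain h n where h: "h \<in> H" "spelled h 1 0 n" using dense_spelled[OF H spelled_gs_a] by blast
  have r: "root (inverse h) 1 = 0" using root_spelled[OF spelled_inverse[OF h(2)]] by simp
  have a: "gs_a \<in> secs H 1" using secsI[OF t, of 1] by (simp add: sec_gs_t)
  have "h * gs_t * inverse h \<in> H" by (intro m h t)
  then have "sec (h * gs_t * inverse h) 1 \<in> secs H 1" by (rule secsI) simp
  then have k: "sec h 0 * gs_t * inverse (sec h 0) \<in> secs H 1" by (simp add: r sec_inverse sec_gs_t mult.assoc)
  obtain i j n' where "spelled (sec h 0) i j n'" using sec_GS[of h] h HG by (blast elim: GSE)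
  from dense_eq_GS_of_conj[OF dense_secs[OF H] a this k] show ?thesis
    by (rule dense_eq_GS_of_secs[OF H])
qed

text \<open>
  Descent on the length of an element whose exponent sum \<open>j\<close> in
  \<open>t\<close> is not zero. If it fixes the first level, one of its sections has the
  same property, and this section is shorter unless it is a power of \<open>t\<close>. If it
  moves the letters, then the sections of its cube are products of all three sections of the
  element: the exponent sum in \<open>t\<close> and the length are unchanged, and the
  exponent sum of \<open>a\<close> is zero. The second summand of the measure accounts for
  this extra step.
\<close>

lemma dense_eq_GS_of_spelled:
  assumes "dense H" "g \<in> H" "spelled g i j n" "j \<noteq> 0" shows "H = GS"
  using assms
proof (induction "2 * n + (if i = 0 then 0 else 1)" arbitrary: H g i j n rule: less_induct)
  case less
  note H = less.prems(1)
  have sH: "subgrp H" using H by (simp add: dense_def)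
  obtain J N where JN: "\<And>y. spelled (sec g (y - i)) (J (y - 1) - J (y + 1)) (J y) (N y)"
    "J 0 + J 1 + J 2 = j" "N 0 + N 1 + N 2 = n"
    "\<And>y. N y = n \<Longrightarrow> \<exists>k. of_nat k = j \<and> sec g (y - i) = gs_t ^ k"
    using spelled_sections[OF less.prems(3)] by metis
  have rg: "root g y = y + i" for y by (rule root_spelled[OF less.prems(3)])
  show ?case
  proof (cases "i = 0")
    case False
    \<comment> \<open>the section of the cube at \<open>0\<close>, in terms of positions counted after applying \<open>g\<close>\<close>
    let ?h = "sec g (0 - i) * sec g (i + i - i) * sec g (i - i)"
    have s: "sec (g * (g * g)) 0 = ?h"
      by (cases i rule: letter_cases) (simp_all add: rg mult.assoc letter_numerals)
    have "g * (g * g) \<in> H" by (intro subgrpD[OF sH] less.prems)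
    then have "sec (g * (g * g)) 0 \<in> secs H 0"
      by (rule secsI) (cases i rule: letter_cases; simp add: rg)
    then have h: "?h \<in> secs H 0" unfolding s .
    have "spelled ?h (J (0 - 1) - J (0 + 1) + (J (i + i - 1) - J (i + i + 1)) + (J (i - 1) - J (i + 1)))
       (J 0 + J (i + i) + J i) (N 0 + N (i + i) + N i)"
      by (intro spelled_mult JN(1))
    moreover have "J (0 - 1) - J (0 + 1) + (J (i + i - 1) - J (i + i + 1)) + (J (i - 1) - J (i + 1)) = 0"
      "J 0 + J (i + i) + J i = j" "N 0 + N (i + i) + N i = n"
      using False JN(2,3) by (cases i rule: letter_cases; simp add: letter_numerals ac_simps)+
    ultimately have "spelled ?h 0 j n" by simp
    from less.hyps[OF _ dense_secs[OF H] h this] have "secs H 0 = GS" using False less.prems(4) by simp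
    then show ?thesis by (rule dense_eq_GS_of_secs[OF H])
  next
    case True
    have S: "sec g y \<in> secs H y" for y by (intro secsI less.prems) (simp add: rg True)
    obtain y where y: "J y \<noteq> 0" using JN(2) less.prems(4) by (metis add_0)
    show ?thesis
    proof (cases "N y < n")
      case True': True
      have "secs H y = GS"
        by (rule less.hyps[OF _ dense_secs[OF H] S _ y, of "N y"])
           (use JN(1)[of y] True True' in auto)
      then show ?thesis by (rule dense_eq_GS_of_secs[OF H])
    next
      case False
      then have "N y = n" using JN(3) by (cases y rule: letter_cases) auto
      then obtain k where k: "of_nat k = j" "sec g y = gs_t ^ k" using JN(4)[of y] True by auto
      \<comment> \<open>a power of \<open>t\<close> with exponent prime to 3 generates the same group as \<open>t\<close>\<close>
      have "k mod 3 = 1 \<or> k mod 3 = 2"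
      proof -
        have "k mod 3 \<noteq> 0"
        proof
          assume "k mod 3 = 0"
          then obtain l where "k = 3 * l" by auto
          then show False using k(1) less.prems(4) by (simp add: letter_numerals)
        qed
        then show ?thesis by linarith
      qed
      moreover have "gs_t ^ (k mod 3) \<in> secs H y" using S[of y] k(2) power_mod_3[OF gs_t_cube, of k] by simp
      ultimately have "gs_t \<in> secs H y \<or> inverse gs_t \<in> secs H y"
        by (auto simp: inverse_gs_t power2_eq_square)
      then have "gs_t \<in> secs H y" using subgrpD(3)[OF subgrp_secs[OF sH, of y], of "inverse gs_t"] by auto
      then have "secs H y = GS" by (rule dense_eq_GS_of_gs_t[OF dense_secs[OF H]])
      then show ?thesis by (rule dense_eq_GS_of_secs[OF H])
    qed
  qed
qed

lemma dense_eq_GS: assumes "dense H" shows "H = GS"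
proof -
  obtain h n where "h \<in> H" "spelled h 0 1 n" using dense_spelled[OF assms spelled_gs_t] by blast
  then show ?thesis by (intro dense_eq_GS_of_spelled[OF assms]) auto
qed

section \<open>The wreath product with the symmetric group of degree three\<close>

definition GS_wr_S3 :: "3 aut set" where "GS_wr_S3 = {g. \<forall>x. sec g x \<in> GS}"

lemma subgrp_GS_wr_S3: "subgrp GS_wr_S3"
  using subgrpD[OF subgrp_GS] by (auto simp: subgrp_def GS_wr_S3_def sec_inverse)

lemma GS_subset_GS_wr_S3: "GS \<subseteq> GS_wr_S3"
  by (auto simp: GS_wr_S3_def sec_GS)

lemma put_GS_wr_S3: "z \<in> GS \<Longrightarrow> put x z \<in> GS_wr_S3"
  using subgrpD(1)[OF subgrp_GS] by (auto simp: GS_wr_S3_def sec_put)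

lemma finitely_covered_GS_wr_S3: "finitely_covered GS_wr_S3 (layer (Suc n) GS'')"
  using finitely_covered_layer_1[OF _ finitely_covered_layer, of GS_wr_S3 n] by (simp add: GS_wr_S3_def)

lemma layer_GS_wr_S3: "layer (Suc n) GS'' \<subseteq> GS_wr_S3"
proof -
  have "layer n GS'' \<subseteq> GS"
    using layer_mono[OF GS''_subset, of n] layer_GS'[of n] GS'_subset by (meson order_trans)
  then show ?thesis by (auto simp: GS_wr_S3_def)
qed

lemma normalised_by_layer_GS_wr_S3: "normalised_by (layer (Suc n) GS'') GS_wr_S3"
proof -
  have "g * l * inverse g \<in> layer (Suc n) GS''"
    if g: "g \<in> GS_wr_S3" and l: "l \<in> layer (Suc n) GS''" for g l
    using normalised_byD(2)[OF normalised_by_layer[of n]] g l by (auto simp: sec_inverse GS_wr_S3_def)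
  then show ?thesis
    using subgrp_layer[OF subgrp_commsub] by (auto simp: normalised_by_def simp del: layer.simps)
qed

lemma dense_eq_GS_wr_S3:
  assumes M: "subgrp M" "M \<subseteq> GS_wr_S3" and le: "\<And>n. GS_wr_S3 \<subseteq> setmult M (layer (Suc n) GS'')"
  shows "M = GS_wr_S3"
proof -
  have "dense (secs M x)" for x
    unfolding dense_def
  proof (intro conjI allI)
    show "subgrp (secs M x)" by (rule subgrp_secs[OF M(1)])
    show "secs M x \<subseteq> GS" using M(2) by (auto simp: secs_def GS_wr_S3_def)
    show "GS \<subseteq> setmult (secs M x) (layer n GS'')" for n
      by (rule secs_setmult[OF _ le]) (use put_GS_wr_S3 in \<open>auto intro!: bexI[of _ "put x _"]\<close>)
  qed
  then have "secs M x = GS" for x by (rule dense_eq_GS)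
  moreover have "layer 1 GS' \<subseteq> GS_wr_S3" using GS'_subset by (auto simp: GS_wr_S3_def)
  moreover have "GS_wr_S3 \<subseteq> setmult M (layer 1 GS'')" using le[of 0] by simp
  ultimately have "GS_wr_S3 \<subseteq> M" by (rule subset_of_secs[OF M(1)])
  with M(2) show ?thesis by blast
qed

lemma subgrp_setmult:
  assumes M: "subgrp M" and N: "normalised_by N M"
  shows "subgrp (setmult M N)"
proof -
  note m = subgrpD[OF M] and n = subgrpD[OF normalised_byD(1)[OF N]]
  have I: "x * l \<in> setmult M N" if "x \<in> M" "l \<in> N" for x l using that by (auto simp: setmult_def)
  show ?thesis unfolding subgrp_def
  proof (intro conjI ballI)
    show "1 \<in> setmult M N" using I[OF m(1) n(1)] by simp
    fix a b assume "a \<in> setmult M N"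
    then obtain x l where a: "a = x * l" "x \<in> M" "l \<in> N" by (auto simp: setmult_def)
    have "inverse a = inverse x * (x * inverse l * inverse x)" by (simp add: a mult.assoc)
    also have "\<dots> \<in> setmult M N"
      by (rule I[OF m(3)[OF a(2)] normalised_byD(2)[OF N a(2) n(3)[OF a(3)]]])
    finally show "inverse a \<in> setmult M N" .
    assume "b \<in> setmult M N"
    then obtain y k where b: "b = y * k" "y \<in> M" "k \<in> N" by (auto simp: setmult_def)
    have "a * b = (x * y) * ((inverse y * l * inverse (inverse y)) * k)" by (simp add: a b mult.assoc)
    also have "\<dots> \<in> setmult M N"
      by (rule I[OF m(2)[OF a(2) b(2)] n(2)[OF normalised_byD(2)[OF N m(3)[OF b(2)] a(3)] b(3)]])
    finally show "a * b \<in> setmult M N" .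
  qed
qed

text \<open>
  A maximal subgroup either contains \<open>layer n\<close> of the second derived subgroup
  for some \<open>n\<close>, and then has finite index, or it is dense.
\<close>

lemma maximal_in_GS_wr_S3:
  assumes M: "subgrp M" "M \<subseteq> GS_wr_S3" "M \<noteq> GS_wr_S3"
    and max: "\<And>K. subgrp K \<Longrightarrow> K \<subseteq> GS_wr_S3 \<Longrightarrow> M \<subseteq> K \<Longrightarrow> K = M \<or> K = GS_wr_S3"
  shows "finitely_covered GS_wr_S3 M"
proof -
  obtain n where n: "\<not> GS_wr_S3 \<subseteq> setmult M (layer (Suc n) GS'')"
    using dense_eq_GS_wr_S3[OF M(1,2)] M(3) by blast
  let ?N = "layer (Suc n) GS''" and ?K = "setmult M (layer (Suc n) GS'')"
  note m = subgrpD(1)[OF M(1)] and l = subgrpD(1)[OF normalised_byD(1)[OF normalised_by_layer_GS_wr_S3[of n]]]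
  have "subgrp ?K"
    by (intro subgrp_setmult M normalised_by_mono[OF normalised_by_layer_GS_wr_S3])
  moreover have "?K \<subseteq> GS_wr_S3"
    using M(2) layer_GS_wr_S3[of n] subgrpD(2)[OF subgrp_GS_wr_S3] unfolding setmult_def by blast
  moreover have "M \<subseteq> ?K"
  proof
    fix x assume "x \<in> M"
    then have "x * 1 \<in> ?K" using l unfolding setmult_def by blast
    then show "x \<in> ?K" by (simp only: mult_1_right)
  qed
  ultimately have "?K = M" using max n by blast
  moreover have "?N \<subseteq> ?K"
  proof
    fix x assume "x \<in> ?N"
    then have "1 * x \<in> ?K" using m unfolding setmult_def by blast
    then show "x \<in> ?K" by (simp only: mult_1_left)
  qed
  ultimately show ?thesis using finitely_covered_mono[OF finitely_covered_GS_wr_S3[of n], of M] by simp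
qed

definition rooted :: "(3 \<Rightarrow> 3) \<Rightarrow> 3 aut" where "rooted p = mk p (\<lambda>_. 1)"

lemma rooted_GS_wr_S3: "bij p \<Longrightarrow> rooted p \<in> GS_wr_S3"
  by (simp add: rooted_def GS_wr_S3_def subgrpD(1)[OF subgrp_GS])

lemma root_rooted: "bij p \<Longrightarrow> root (rooted p) = p"
  by (simp add: rooted_def)

lemma GS_wr_S3_least:
  assumes K: "subgrp K" and p: "\<And>p. bij p \<Longrightarrow> rooted p \<in> K"
    and g: "\<And>x. put x gs_a \<in> K" "\<And>x. put x gs_t \<in> K"
  shows "GS_wr_S3 \<subseteq> K"
proof
  fix h assume h: "h \<in> GS_wr_S3"
  have "GS \<subseteq> {z. put x z \<in> K}" for x
    using subgrpD[OF K] g by (intro GS_least) (auto simp: subgrp_def put_mult put_inverse)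
  then have l: "layer 1 GS \<subseteq> K" by (intro layer_1_least K) blast
  let ?r = "rooted (root h)"
  have r: "root ?r = root h" by (simp add: root_rooted bij_root)
  have rr: "root (inverse ?r) (root h x) = x" for x by (metis r root_inverse_cancel(1))
  have "sec (inverse ?r) x = 1" for x by (simp add: sec_inverse rooted_def bij_root)
  then have "inverse ?r * h \<in> layer 1 GS" using h by (simp add: rr GS_wr_S3_def)
  then have "?r * (inverse ?r * h) \<in> K" using l p[OF bij_root] subgrpD(2)[OF K] by blast
  then show "h \<in> K" by simp
qed

definition stab0 :: "3 aut set" where "stab0 = {g \<in> GS_wr_S3. root g 0 = 0}"

lemma subgrp_stab0: "subgrp stab0"
proof -
  have "root (inverse g) 0 = 0" if "root g 0 = 0" for g :: "3 aut"
    using that by (metis root_inverse_cancel(1))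
  then show ?thesis using subgrpD[OF subgrp_GS_wr_S3] by (auto simp: stab0_def subgrp_def)
qed

text \<open>
  A subgroup that properly contains the stabiliser of the letter \<open>0\<close> is
  transitive on the letters, because the stabiliser permutes the other two letters
  transitively.
\<close>

lemma stab0_maximal:
  assumes K: "subgrp K" "K \<subseteq> GS_wr_S3" "stab0 \<subseteq> K" shows "K = stab0 \<or> K = GS_wr_S3"
proof (rule disjCI)
  assume "K \<noteq> GS_wr_S3"
  note k = subgrpD[OF K(1)]
  have "root c 0 = 0" if c: "c \<in> K" for c
  proof (rule ccontr)
    assume c0: "root c 0 \<noteq> 0"
    have "g \<in> K" if g: "g \<in> GS_wr_S3" for g
    proof (cases "root g 0 = 0")
      case True
      then show ?thesis using g K(3) by (auto simp: stab0_def)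
    next
      case False
      let ?p = "\<lambda>x. if x = root c 0 then root g 0 else if x = root g 0 then root c 0 else x"
      have p: "bij ?p" by (rule o_bij[of ?p]) (auto simp: fun_eq_iff)
      have "rooted ?p \<in> stab0"
        using c0 False p by (auto simp: stab0_def rooted_GS_wr_S3 root_rooted)
      then have "rooted ?p * c \<in> K" using K(3) k(2) c by blast
      moreover have "root (rooted ?p * c) 0 = root g 0" using p by (simp add: root_rooted)
      ultimately obtain d where d: "d \<in> K" "root d 0 = root g 0" by blast
      have "inverse d * g \<in> GS_wr_S3"
        using subgrpD(2)[OF subgrp_GS_wr_S3 subgrpD(3)[OF subgrp_GS_wr_S3 subsetD[OF K(2) d(1)]] g] .
      then have "inverse d * g \<in> K" using K(3) by (auto simp: stab0_def d(2)[symmetric])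
      then have "d * (inverse d * g) \<in> K" by (rule k(2)[OF d(1)])
      then show ?thesis by (simp only: mult_inverse_cancel)
    qed
    then show False using \<open>K \<noteq> GS_wr_S3\<close> K(2) by blast
  qed
  then show "K = stab0" using K by (auto simp: stab0_def)
qed

lemma stab0_proper: "gs_a \<in> GS_wr_S3" "gs_a \<notin> stab0"
  using GS_subset_GS_wr_S3 gs_a_GS by (auto simp: stab0_def)

lemma stab0_not_normal: "\<exists>h\<in>stab0. gs_a * h * inverse gs_a \<notin> stab0"
proof -
  \<comment> \<open>negation fixes \<open>0\<close> and exchanges the other two letters\<close>
  let ?p = "\<lambda>x :: 3. - x"
  have p: "bij ?p" by (rule o_bij[of ?p]) auto
  have "rooted ?p \<in> stab0" using p by (simp add: stab0_def rooted_GS_wr_S3 root_rooted)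
  moreover have "root (gs_a * rooted ?p * inverse gs_a) 0 \<noteq> 0" using p by (simp add: root_rooted)
  ultimately show ?thesis by (auto simp: stab0_def)
qed

lemma act_put_word: "w \<notin> range ((@) u) \<Longrightarrow> act (put_word u z) w = w"
proof (induction u arbitrary: w)
  case (Cons x u)
  show ?case
  proof (cases w)
    case [simp]: (Cons y w')
    show ?thesis
    proof (cases "y = x")
      case True
      then have "w' \<notin> range ((@) u)" using Cons.prems by auto
      then show ?thesis using Cons.IH True by simp
    qed (simp add: sec_put)
  qed simp
qed auto

lemma act_snoc: "\<exists>y. act g (u @ [x]) = act g u @ [y]"
proof -
  have "take (length u) (act g (u @ [x])) = act g u" by (simp add: take_act)
  moreover have "length (drop (length u) (act g (u @ [x]))) = 1" by simp
  then obtain y where "drop (length u) (act g (u @ [x])) = [y]" by (auto simp: length_Suc_conv simp del: length_drop)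
  ultimately show ?thesis by (metis append_take_drop_id)
qed

text \<open>
  Adjacency in the tree is expressed by appending a letter at the end of a word, whereas
  sections are taken at the first letter.
\<close>

lemma act_snoc_iff: "(\<exists>y. act g v = act g u @ [y]) \<longleftrightarrow> (\<exists>x. v = u @ [x])"
proof
  assume "\<exists>y. act g v = act g u @ [y]"
  then obtain y where "act g v = act g u @ [y]" by blast
  with act_snoc[of "inverse g" "act g u" y] show "\<exists>x. v = u @ [x]" by (metis act_inverse_cancel(1))
qed (auto simp: act_snoc)

section \<open>Realisation over an alphabet of natural numbers\<close>

definition letter_code :: "3 \<Rightarrow> nat" where
  "letter_code x = (if x = 0 then 0 else if x = 1 then 1 else 2)"

lemma inj_letter_code: "inj letter_code"
proof (rule injI)
  fix x y :: 3 assume "letter_code x = letter_code y"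
  then show "x = y" by (cases x rule: letter_cases; cases y rule: letter_cases) (auto simp: letter_code_def)
qed

abbreviation alphabet :: "nat set" where "alphabet \<equiv> range letter_code"

abbreviation encode :: "3 list \<Rightarrow> nat list" where "encode \<equiv> map letter_code"

lemma encode_eq_iff [simp]: "encode u = encode v \<longleftrightarrow> u = v"
  using inj_letter_code by (simp add: inj_map_eq_map)

lemma lists_alphabet: "lists alphabet = range encode"
  by (simp add: lists_image)

lemma encode_lists: "encode u \<in> lists alphabet"
  by (simp add: lists_alphabet)

text \<open>
  The embedding into the group of automorphisms of \<open>lists alphabet\<close>, which are
  extensional functions.
\<close>

definition realise :: "3 aut \<Rightarrow> nat list \<Rightarrow> nat list" where
  "realise g = (\<lambda>u\<in>lists alphabet. encode (act g (inv_into UNIV encode u)))"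

lemma realise_encode: "realise g (encode u) = encode (act g u)"
proof -
  have "inv_into UNIV encode (encode u) = u"
    by (rule inv_into_f_f) (auto simp: inj_def)
  then show ?thesis by (simp add: realise_def encode_lists)
qed

lemma realise_ext: "u \<notin> lists alphabet \<Longrightarrow> realise g u = undefined"
  by (simp add: realise_def)

lemma fun_eq_on_lists:
  assumes "\<And>u. f (encode u) = g (encode u)" "\<And>u. u \<notin> lists alphabet \<Longrightarrow> f u = g u"
  shows "f = g"
proof
  fix u show "f u = g u" using assms by (cases "u \<in> lists alphabet") (auto simp: lists_alphabet)
qed

lemma realise_eq_iff [simp]: "realise g = realise h \<longleftrightarrow> g = h"
proof
  assume "realise g = realise h"
  then have "encode (act g u) = encode (act h u)" for u by (metis realise_encode)
  then show "g = h" by (intro aut_eq_actI) simp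
qed simp

lemma compose_realise: "compose (lists alphabet) (realise g) (realise h) = realise (g * h)"
  by (rule fun_eq_on_lists) (simp_all add: compose_def realise_encode encode_lists realise_ext)

lemma realise_one: "realise 1 = (\<lambda>u\<in>lists alphabet. u)"
  by (rule fun_eq_on_lists) (simp_all add: realise_encode encode_lists realise_ext)

lemma realise_Bij: "realise g \<in> Bij (lists alphabet)"
proof -
  have "realise g ` lists alphabet = lists alphabet"
  proof
    show "realise g ` lists alphabet \<subseteq> lists alphabet"
      by (auto simp: lists_alphabet realise_encode simp del: map_eq_conv)
    show "lists alphabet \<subseteq> realise g ` lists alphabet"
    proof
      fix u assume "u \<in> lists alphabet"
      then obtain w where "u = encode w" by (auto simp: lists_alphabet)
      then have "u = realise g (encode (act (inverse g) w))" by (simp add: realise_encode)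
      then show "u \<in> realise g ` lists alphabet" using encode_lists by blast
    qed
  qed
  moreover have "inj_on (realise g) (lists alphabet)"
    by (rule inj_onI) (auto simp: lists_alphabet realise_encode)
  ultimately show ?thesis by (auto simp: Bij_def bij_betw_def realise_def)
qed

lemma tree_adj_encode:
  "tree_adj alphabet (encode u) (encode v) \<longleftrightarrow> (\<exists>x. v = u @ [x]) \<or> (\<exists>x. u = v @ [x])"
proof -
  have "(\<exists>y\<in>alphabet. encode v = encode u @ [y]) \<longleftrightarrow> (\<exists>x. v = u @ [x])" for u v
  proof -
    have "encode u @ [letter_code x] = encode (u @ [x])" for x by simp
    then show ?thesis by (metis encode_eq_iff rangeE rangeI)
  qed
  then show ?thesis unfolding tree_adj_def by (auto simp: encode_lists)
qed

lemma realise_carrier: "realise g \<in> carrier (tree_Aut alphabet)"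
proof -
  have "realise g [] = []" using realise_encode[of g "[]"] by simp
  moreover have "tree_adj alphabet (realise g u) (realise g v) \<longleftrightarrow> tree_adj alphabet u v"
    if "u \<in> lists alphabet" "v \<in> lists alphabet" for u v
    using that by (auto simp: lists_alphabet realise_encode tree_adj_encode act_snoc_iff)
  ultimately show ?thesis by (simp add: tree_Aut_def realise_Bij)
qed

lemma mult_realise: "realise g \<otimes>\<^bsub>tree_Aut alphabet\<^esub> realise h = realise (g * h)"
  by (simp add: tree_Aut_def BijGroup_def realise_Bij compose_realise)

lemma one_realise: "\<one>\<^bsub>tree_Aut alphabet\<^esub> = realise 1"
  by (simp add: tree_Aut_def BijGroup_def realise_one)

lemma subgroup_realise:
  assumes "subgrp G" shows "subgroup (realise ` G) (tree_Aut alphabet)"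
proof -
  interpret T: group "tree_Aut alphabet" by (rule group_tree_Aut)
  note g = subgrpD[OF assms]
  have inv: "inv\<^bsub>tree_Aut alphabet\<^esub> (realise x) = realise (inverse x)" for x
    by (rule T.inv_equality) (simp_all add: realise_carrier mult_realise one_realise)
  show ?thesis
    by (rule T.subgroupI) (use g in \<open>auto simp: inv mult_realise realise_carrier\<close>)
qed

abbreviation "grp G \<equiv> tree_grp alphabet (realise ` G)"

lemma group_grp: "subgrp G \<Longrightarrow> group (grp G)"
  by (rule group_tree_grp[OF subgroup_realise])

lemma inv_grp:
  assumes "subgrp G" "x \<in> G" shows "inv\<^bsub>grp G\<^esub> (realise x) = realise (inverse x)"
  by (rule group.inv_equality[OF group_grp[OF assms(1)]])
     (use assms subgrpD(3)[OF assms] in \<open>auto simp: mult_realise one_realise\<close>)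

lemma subgroup_grp_iff:
  assumes G: "subgrp G" and S: "S \<subseteq> G"
  shows "subgroup (realise ` S) (grp G) \<longleftrightarrow> subgrp S"
proof
  assume "subgroup (realise ` S) (grp G)"
  then interpret subgroup "realise ` S" "grp G" .
  show "subgrp S" unfolding subgrp_def
  proof (intro conjI ballI)
    show "1 \<in> S" using one_closed by (auto simp: one_realise)
    fix x y assume x: "x \<in> S" and y: "y \<in> S"
    show "x * y \<in> S" using m_closed[of "realise x" "realise y"] x y by (auto simp: mult_realise)
    show "inverse x \<in> S" using m_inv_closed[of "realise x"] x inv_grp[OF G subsetD[OF S x]] by auto
  qed
next
  assume "subgrp S"
  note s = subgrpD[OF this]
  show "subgroup (realise ` S) (grp G)"
    by (rule group.subgroupI[OF group_grp[OF G]])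
       (use s S in \<open>auto simp: inv_grp[OF G] mult_realise subset_iff\<close>)
qed

lemma subgroup_grpE:
  assumes G: "subgrp G" and K: "subgroup K (grp G)"
  obtains S where "K = realise ` S" "subgrp S" "S \<subseteq> G"
proof -
  define S where "S = {g \<in> G. realise g \<in> K}"
  have "K = realise ` S" using subgroup.subset[OF K] by (auto simp: S_def)
  moreover have "S \<subseteq> G" by (auto simp: S_def)
  ultimately show ?thesis using that K subgroup_grp_iff[OF G] by metis
qed

lemma finite_index_grp:
  assumes G: "subgrp G" and S: "subgrp S" "S \<subseteq> G" and fin: "finitely_covered G S"
  shows "finite_index (realise ` S) (grp G)"
proof -
  obtain F where F: "finite F" "\<And>g. g \<in> G \<Longrightarrow> \<exists>f\<in>F. g * inverse f \<in> S"
    using fin unfolding finitely_covered_def by blast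
  note s = subgrpD[OF S(1)]
  have "rcosets\<^bsub>grp G\<^esub> (realise ` S) \<subseteq> (\<lambda>f. (\<lambda>x. realise (x * f)) ` S) ` F"
  proof
    fix C assume "C \<in> rcosets\<^bsub>grp G\<^esub> (realise ` S)"
    then obtain g where g: "g \<in> G" and C: "C = (realise ` S) #>\<^bsub>grp G\<^esub> (realise g)"
      by (auto simp: RCOSETS_def)
    obtain f where f: "f \<in> F" "g * inverse f \<in> S" using F(2)[OF g] by blast
    have "C = (\<lambda>x. realise (x * g)) ` S" by (auto simp: C r_coset_def mult_realise)
    also have "\<dots> = (\<lambda>x. realise (x * f)) ` S"
    proof (intro equalityI subsetI)
      fix c assume "c \<in> (\<lambda>x. realise (x * g)) ` S"
      then obtain x where x: "x \<in> S" "c = realise (x * g)" by blast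
      have "c = realise (x * (g * inverse f) * f)" by (simp add: x mult.assoc)
      then show "c \<in> (\<lambda>x. realise (x * f)) ` S" using s(2)[OF x(1) f(2)] by blast
    next
      fix c assume "c \<in> (\<lambda>x. realise (x * f)) ` S"
      then obtain x where x: "x \<in> S" "c = realise (x * f)" by blast
      have "c = realise (x * inverse (g * inverse f) * g)" by (simp add: x mult.assoc)
      then show "c \<in> (\<lambda>x. realise (x * g)) ` S" using s(2)[OF x(1) s(3)[OF f(2)]] by blast
    qed
    finally show "C \<in> (\<lambda>f. (\<lambda>x. realise (x * f)) ` S) ` F" using f(1) by blast
  qed
  then have "finite (rcosets\<^bsub>grp G\<^esub> (realise ` S))" using F(1) finite_subset by blast
  then show ?thesis using subgroup_grp_iff[OF G S(2)] S(1) by (simp add: finite_index_def)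
qed

lemma maximal_grp_iff:
  assumes G: "subgrp G" and S: "S \<subseteq> G"
  shows "maximal_subgroup (realise ` S) (grp G) \<longleftrightarrow>
    subgrp S \<and> S \<noteq> G \<and> (\<forall>K. subgrp K \<and> K \<subseteq> G \<and> S \<subseteq> K \<longrightarrow> K = S \<or> K = G)"
proof -
  have i: "realise ` S = realise ` K \<longleftrightarrow> S = K" "realise ` S \<subseteq> realise ` K \<longleftrightarrow> S \<subseteq> K" for S K
    by (auto simp: inj_image_eq_iff inj_image_subset_iff inj_def)
  have "(\<forall>K. subgroup K (grp G) \<and> realise ` S \<subseteq> K \<longrightarrow> K = realise ` S \<or> K = realise ` G) \<longleftrightarrow>
    (\<forall>K. subgrp K \<and> K \<subseteq> G \<and> S \<subseteq> K \<longrightarrow> K = S \<or> K = G)"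
    (is "?l \<longleftrightarrow> ?r")
  proof
    assume ?l then show ?r using subgroup_grp_iff[OF G] by (metis i)
  next
    assume r: ?r
    show ?l
    proof (intro allI impI)
      fix K assume K: "subgroup K (grp G) \<and> realise ` S \<subseteq> K"
      then obtain L where L: "K = realise ` L" "subgrp L" "L \<subseteq> G" using subgroup_grpE[OF G] by metis
      then show "K = realise ` S \<or> K = realise ` G" using r K i(2) by metis
    qed
  qed
  then show ?thesis unfolding maximal_subgroup_def using subgroup_grp_iff[OF G S] i(1) by simp
qed

lemma in_MF_GS_wr_S3: "in_MF (grp GS_wr_S3)"
  unfolding in_MF_def
proof (intro conjI allI impI)
  show "group (grp GS_wr_S3)" by (rule group_grp[OF subgrp_GS_wr_S3])
  fix M assume M: "maximal_subgroup M (grp GS_wr_S3)"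
  then have "subgroup M (grp GS_wr_S3)" by (simp add: maximal_subgroup_def)
  then obtain S where S: "M = realise ` S" "subgrp S" "S \<subseteq> GS_wr_S3" by (rule subgroup_grpE[OF subgrp_GS_wr_S3])
  then have "S \<noteq> GS_wr_S3" "\<And>K. subgrp K \<Longrightarrow> K \<subseteq> GS_wr_S3 \<Longrightarrow> S \<subseteq> K \<Longrightarrow> K = S \<or> K = GS_wr_S3"
    using M maximal_grp_iff[OF subgrp_GS_wr_S3] by auto
  then have "finitely_covered GS_wr_S3 S" by (rule maximal_in_GS_wr_S3[OF S(2,3)])
  then show "finite_index M (grp GS_wr_S3)"
    unfolding S(1) by (rule finite_index_grp[OF subgrp_GS_wr_S3 S(2,3)])
qed

lemma not_in_MN_GS_wr_S3: "\<not> in_MN (grp GS_wr_S3)"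
proof
  assume "in_MN (grp GS_wr_S3)"
  moreover have s: "stab0 \<subseteq> GS_wr_S3" by (auto simp: stab0_def)
  have "maximal_subgroup (realise ` stab0) (grp GS_wr_S3)"
    unfolding maximal_grp_iff[OF subgrp_GS_wr_S3 s]
    using subgrp_stab0 stab0_maximal stab0_proper by blast
  ultimately have "normal (realise ` stab0) (grp GS_wr_S3)" by (simp add: in_MN_def)
  then interpret N: normal "realise ` stab0" "grp GS_wr_S3" .
  obtain h where h: "h \<in> stab0" "gs_a * h * inverse gs_a \<notin> stab0" using stab0_not_normal by blast
  have "realise gs_a \<otimes>\<^bsub>grp GS_wr_S3\<^esub> realise h \<otimes>\<^bsub>grp GS_wr_S3\<^esub> inv\<^bsub>grp GS_wr_S3\<^esub> (realise gs_a) \<in> realise ` stab0"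
    by (rule N.inv_op_closed2) (use stab0_proper h in auto)
  then show False using h(2) by (auto simp: inv_grp[OF subgrp_GS_wr_S3 stab0_proper(1)] mult_realise)
qed

lemma finitely_generated_GS_wr_S3: "finitely_generated_group (grp GS_wr_S3)"
  unfolding finitely_generated_group_def
proof (intro conjI exI)
  show grp: "group (grp GS_wr_S3)" by (rule group_grp[OF subgrp_GS_wr_S3])
  let ?S = "rooted ` {p. bij p} \<union> range (\<lambda>x. put x gs_a) \<union> range (\<lambda>x. put x gs_t)"
  show "finite (realise ` ?S)" by simp
  have S: "?S \<subseteq> GS_wr_S3" using rooted_GS_wr_S3 put_GS_wr_S3 gs_a_GS gs_t_GS by auto
  then show 1: "realise ` ?S \<subseteq> carrier (grp GS_wr_S3)" by auto
  have "subgroup (generate (grp GS_wr_S3) (realise ` ?S)) (grp GS_wr_S3)"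
    by (rule group.generate_is_subgroup[OF grp 1])
  then obtain K where K: "generate (grp GS_wr_S3) (realise ` ?S) = realise ` K" "subgrp K" "K \<subseteq> GS_wr_S3"
    by (rule subgroup_grpE[OF subgrp_GS_wr_S3])
  have "realise ` ?S \<subseteq> realise ` K" unfolding K(1)[symmetric] by (auto intro: generate.incl)
  then have "?S \<subseteq> K" by (simp add: inj_image_subset_iff inj_def del: image_Un)
  then have "GS_wr_S3 \<subseteq> K" by (intro GS_wr_S3_least K(2)) auto
  with K show "generate (grp GS_wr_S3) (realise ` ?S) = carrier (grp GS_wr_S3)" by simp
qed

lemma realise_put_word_rist:
  assumes "put_word u z \<in> GS_wr_S3"
  shows "realise (put_word u z) \<in> rist alphabet (realise ` GS_wr_S3) (encode u)"
  unfolding rist_def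
proof (intro CollectI conjI ballI)
  show "realise (put_word u z) \<in> realise ` GS_wr_S3" using assms by simp
  fix v assume v: "v \<in> lists alphabet - subtree alphabet (encode u)"
  then obtain w where w: "v = encode w" by (auto simp: lists_alphabet)
  have "w \<notin> range ((@) u)"
  proof
    assume "w \<in> range ((@) u)"
    then show False using v w encode_lists by (auto simp: subtree_def)
  qed
  then show "realise (put_word u z) v = v" by (simp add: w realise_encode act_put_word)
qed

text \<open>
  The rigid stabilisers of level \<open>n\<close> are shown to generate a group that
  contains \<open>layer (n + 1)\<close> of the second derived subgroup: this layer is also
  \<open>layer n\<close> of \<open>layer 1\<close>, hence generated by elements that are
  supported below one vertex of level \<open>n\<close>. It has finite index for every
  \<open>n\<close>, including \<open>n = 0\<close>.
\<close>

lemma branch_GS_wr_S3: "branch_group alphabet (realise ` GS_wr_S3)"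
  unfolding branch_group_def
proof (intro conjI allI)
  show "finite alphabet" "alphabet \<noteq> {}" by auto
  show sub: "subgroup (realise ` GS_wr_S3) (tree_Aut alphabet)" by (rule subgroup_realise[OF subgrp_GS_wr_S3])
  have lev: "\<exists>w. u = encode w \<and> length w = n" if "u \<in> level alphabet n" for u n
    using that by (auto simp: level_def lists_alphabet)
  show "spherically_transitive alphabet (realise ` GS_wr_S3)"
    unfolding spherically_transitive_def
  proof (intro allI ballI)
    fix n u v assume "u \<in> level alphabet n" "v \<in> level alphabet n"
    then obtain w w' where w: "u = encode w" "v = encode w'" "length w = length w'" using lev by metis
    then obtain g where "g \<in> GS" "act g w = w'" using GS_transitive by blast
    then show "\<exists>g\<in>realise ` GS_wr_S3. g u = v" using GS_subset_GS_wr_S3 w by (auto simp: realise_encode intro!: bexI[of _ g])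
  qed
  fix n
  let ?U = "\<Union>v\<in>level alphabet n. rist alphabet (realise ` GS_wr_S3) v"
  have U: "?U \<subseteq> carrier (grp GS_wr_S3)" by (auto simp: rist_def)
  have "subgroup (Rist alphabet (realise ` GS_wr_S3) n) (grp GS_wr_S3)"
    unfolding Rist_def by (rule group.generate_is_subgroup[OF group_grp[OF subgrp_GS_wr_S3] U])
  then obtain K where K: "Rist alphabet (realise ` GS_wr_S3) n = realise ` K" "subgrp K" "K \<subseteq> GS_wr_S3"
    by (rule subgroup_grpE[OF subgrp_GS_wr_S3])
  have "layer n (layer 1 GS'') \<subseteq> K"
  proof (rule layer_least[OF K(2)])
    fix u :: "3 list" and z assume u: "length u = n" and z: "z \<in> layer 1 GS''"
    have "1 \<in> layer 1 GS''" by (rule subgrpD(1)[OF subgrp_layer[OF subgrp_commsub]])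
    from put_word_layer[OF z this, of u] have "put_word u z \<in> layer (Suc n) GS''"
      unfolding layer_Suc' u .
    then have "put_word u z \<in> GS_wr_S3" using layer_GS_wr_S3 by blast
    then have "realise (put_word u z) \<in> rist alphabet (realise ` GS_wr_S3) (encode u)" by (rule realise_put_word_rist)
    moreover have "encode u \<in> level alphabet n" using u encode_lists by (simp add: level_def)
    ultimately have "realise (put_word u z) \<in> realise ` K"
      unfolding K(1)[symmetric] Rist_def by (intro generate.incl) blast
    then show "put_word u z \<in> K" by auto
  qed
  then have "finitely_covered GS_wr_S3 K"
    using finitely_covered_mono[OF finitely_covered_GS_wr_S3[of n]] by (simp only: layer_Suc')
  then show "finite_index (Rist alphabet (realise ` GS_wr_S3) n) (grp GS_wr_S3)"
    unfolding K(1) by (rule finite_index_grp[OF subgrp_GS_wr_S3 K(2,3)])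
qed

theorem mainTheorem8:
  shows "\<exists>(A :: nat set) G.
    branch_group A G \<and>
    finitely_generated_group (tree_grp A G) \<and>
    in_MF (tree_grp A G) \<and>
    \<not> in_MN (tree_grp A G)"
  using branch_GS_wr_S3 finitely_generated_GS_wr_S3 in_MF_GS_wr_S3 not_in_MN_GS_wr_S3 by blast

end
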